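(* Let $u$ be a sufficiently smooth solution of the incompressible Euler equations in $\mathbb{R}^3\times[0,\infty)$ with pressure $p$ and vorticity $\omega=\nabla\wedge u$, let $\Omega=\Omega(t)\subset\mathbb{R}^3$ be a smooth material volume carried by the fluid, and suppose $\varpi(t)=\|\omega(t)\|_{L_2(\Omega)}^2\neq 0$ for all $t\ge 0$. Suppose that $\mathcal{P}\,\omega=-\lambda\,\omega$ for all $x\in\Omega$ and $t\ge 0$, where $\lambda=\lambda(x,t)>0$. Assume that at some $t_0>0$, $\lambda>3\mu_m^2$ on $\Omega\times[t_0,\infty)$, where $\mu_m=\max\{|\mu_1|,|\mu_2|,|\mu_3|\}$ and $\mu_1,\mu_2,\mu_3$ are the eigenvalues of the matrix $\mathcal{S}$. Then there exist a finite time $T_0>t_0$ (depending only on $\varpi_0$ and $v_0$) and $T_*\in(t_0,T_0)$ such that $$\limsup_{t\uparrow T_*}\left\|\frac{D\omega}{Dt}\right\|_{L_2(\Omega)}=\infty .$$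
   Context: The incompressible Euler equations in $\mathbb{R}^3\times[0,\infty)$ are $\frac{\partial u}{\partial t}+u\cdot\nabla u=-\nabla p$, $\nabla\cdot u=0$, with velocity $u(x,t)=(u_1,u_2,u_3)$ and scalar pressure $p$. The material derivative is $D/Dt=\partial/\partial t+u\cdot\nabla$, and the vorticity is $\omega=\nabla\wedge u$ (the curl of $u$). The strain matrix is $\mathcal{S}_{ij}=\frac12\left(\frac{\partial u_i}{\partial x_j}+\frac{\partial u_j}{\partial x_i}\right)$ and the Hessian of pressure is $\mathcal{P}_{ij}=\frac{\partial^2p}{\partial x_i\partial x_j}$. One has $\frac{D\omega}{Dt}=\mathcal{S}\omega$, $\nabla\cdot\omega=0$ and $\frac{D^2\omega}{Dt^2}=-\mathcal{P}\omega$. A material volume $\Omega=\Omega(t)$ is a region moving with the fluid, i.e. transported by the flow of $u$. Set $\varpi(t)=\|\omega(t)\|^2_{L_2(\Omega)}=\int_{\Omega}|\omega|^2\,dx$ and $v(t)=-\frac{d}{dt}\left(\frac{1}{2\varpi(t)}\right)=\frac{1}{\varpi^2}\int_\Omega\omega\cdot\frac{D\omega}{Dt}\,dx$; $\varpi_0=\varpi(t_0)$ and $v_0=v(t_0)$.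
   Formalization: The hypothesis v_0 > 0 is added: without it the claim is false, e.g. for the linear flow with axial strain -1/(4(1+t)) and vorticity (0,0,(1+t)^(-1/4)), where v_0 < 0 and the norm of Dω/Dt stays bounded. *)

theory Defs
  imports "HOL-Analysis.Analysis"
begin

text \<open>
  Space-time fields are curried, position first: \<open>f x t\<close> with \<open>x \<in> \<real>\<^sup>3\<close> and \<open>t \<ge> 0\<close>.
\<close>

type_synonym scalar_field = "real^3 \<Rightarrow> real \<Rightarrow> real"
type_synonym vector_field = "real^3 \<Rightarrow> real \<Rightarrow> real^3"


section \<open>Regularity\<close>

text \<open>
  Class $C^k$ on a set. Derivatives are taken within the set, so that on the closed half space
  \<open>UNIV \<times> {0..}\<close> the time derivative at \<open>t = 0\<close> is one-sided; on open sets and on that half space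
  the derivative within the set is unique, and this is the usual notion.
\<close>

primrec Ck_on :: "nat \<Rightarrow> ('a::euclidean_space \<Rightarrow> 'b::real_normed_vector) \<Rightarrow> 'a set \<Rightarrow> bool" where
  "Ck_on 0 f A \<longleftrightarrow> continuous_on A f"
| "Ck_on (Suc k) f A \<longleftrightarrow>
     (\<exists>f'. (\<forall>x\<in>A. (f has_derivative f' x) (at x within A)) \<and> (\<forall>v. Ck_on k (\<lambda>x. f' x v) A))"

definition smooth_field :: "(real^3 \<Rightarrow> real \<Rightarrow> 'b::real_normed_vector) \<Rightarrow> bool" where
  "smooth_field f \<longleftrightarrow> Ck_on 2 (\<lambda>(x, t). f x t) (UNIV \<times> {0..})"


section \<open>Differential operators\<close>

definition partial :: "3 \<Rightarrow> (real^3 \<Rightarrow> 'b::real_normed_vector) \<Rightarrow> real^3 \<Rightarrow> 'b" where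
  "partial j f x = vector_derivative (\<lambda>h. f (x + h *\<^sub>R axis j 1)) (at 0)"

definition time_deriv :: "(real^3 \<Rightarrow> real \<Rightarrow> 'b::real_normed_vector) \<Rightarrow> real^3 \<Rightarrow> real \<Rightarrow> 'b" where
  "time_deriv f x t = vector_derivative (\<lambda>s. f x s) (at t within {0..})"

definition material_deriv ::
  "vector_field \<Rightarrow> (real^3 \<Rightarrow> real \<Rightarrow> 'b::real_normed_vector) \<Rightarrow> real^3 \<Rightarrow> real \<Rightarrow> 'b" where
  "material_deriv u f x t = time_deriv f x t + (\<Sum>j\<in>UNIV. u x t $ j *\<^sub>R partial j (\<lambda>y. f y t) x)"

definition gradient :: "scalar_field \<Rightarrow> vector_field" where
  "gradient p x t = (\<chi> i. partial i (\<lambda>y. p y t) x)"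

definition divergence :: "vector_field \<Rightarrow> scalar_field" where
  "divergence u x t = (\<Sum>i\<in>UNIV. partial i (\<lambda>y. u y t $ i) x)"

definition curl :: "vector_field \<Rightarrow> vector_field" where
  "curl u x t = vector
     [partial 2 (\<lambda>y. u y t $ 3) x - partial 3 (\<lambda>y. u y t $ 2) x,
      partial 3 (\<lambda>y. u y t $ 1) x - partial 1 (\<lambda>y. u y t $ 3) x,
      partial 1 (\<lambda>y. u y t $ 2) x - partial 2 (\<lambda>y. u y t $ 1) x]"

definition strain :: "vector_field \<Rightarrow> real^3 \<Rightarrow> real \<Rightarrow> real^3^3" where
  "strain u x t =
     (\<chi> i j. (partial j (\<lambda>y. u y t $ i) x + partial i (\<lambda>y. u y t $ j) x) / 2)"

definition pressure_hessian :: "scalar_field \<Rightarrow> real^3 \<Rightarrow> real \<Rightarrow> real^3^3" where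
  "pressure_hessian p x t = (\<chi> i j. partial i (partial j (\<lambda>y. p y t)) x)"


section \<open>Euler flow and material volumes\<close>

definition euler_solution :: "vector_field \<Rightarrow> scalar_field \<Rightarrow> bool" where
  "euler_solution u p \<longleftrightarrow>
     (\<forall>x. \<forall>t\<ge>0. material_deriv u u x t = - gradient p x t \<and> divergence u x t = 0)"

text \<open>Bounded open set lying locally on one side of a regular level surface.\<close>

definition smooth_bounded_domain :: "(real^3) set \<Rightarrow> bool" where
  "smooth_bounded_domain A \<longleftrightarrow> open A \<and> bounded A \<and>
     (\<forall>x\<in>frontier A. \<exists>U (\<phi> :: real^3 \<Rightarrow> real). open U \<and> x \<in> U \<and> Ck_on 1 \<phi> U \<and>
        (\<forall>y\<in>U. \<exists>j. partial j \<phi> y \<noteq> 0) \<and> A \<inter> U = {y\<in>U. \<phi> y < 0})"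

text \<open>
  \<open>X a\<close> is the trajectory of the particle that is at \<open>a\<close> at time \<open>0\<close>. The boundary particles are
  required to be carried by the fluid as well. No regularity of \<open>X\<close> in \<open>a\<close> is assumed: it follows
  from that of \<open>u\<close>.
\<close>

definition material_volume :: "vector_field \<Rightarrow> (real \<Rightarrow> (real^3) set) \<Rightarrow> bool" where
  "material_volume u \<Omega> \<longleftrightarrow> smooth_bounded_domain (\<Omega> 0) \<and>
     (\<exists>X :: real^3 \<Rightarrow> real \<Rightarrow> real^3.
        (\<forall>a\<in>closure (\<Omega> 0). X a 0 = a \<and>
           (\<forall>t\<ge>0. (X a has_vector_derivative u (X a t) t) (at t within {0..}))) \<and>
        (\<forall>t\<ge>0. \<Omega> t = (\<lambda>a. X a t) ` \<Omega> 0))"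


section \<open>Eigenvalues of the strain and $L_2$ quantities\<close>

definition eigenvalues :: "real^'n^'n \<Rightarrow> real set" where
  "eigenvalues A = {\<mu>. \<exists>v. v \<noteq> 0 \<and> A *v v = \<mu> *\<^sub>R v}"

text \<open>
  Applied to the symmetric matrix \<open>strain u x t\<close> only, whose set of (real) eigenvalues is
  finite and nonempty, so that the maximum is attained.
\<close>

definition max_abs_eigenvalue :: "real^'n^'n \<Rightarrow> real" where
  "max_abs_eigenvalue A = Max (abs ` eigenvalues A)"

definition L2_norm :: "(real^3) set \<Rightarrow> (real^3 \<Rightarrow> real^3) \<Rightarrow> real" where
  "L2_norm A f = sqrt (LINT x:A|lebesgue. (norm (f x))\<^sup>2)"

definition enstrophy :: "vector_field \<Rightarrow> (real \<Rightarrow> (real^3) set) \<Rightarrow> real \<Rightarrow> real" where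
  "enstrophy u \<Omega> t = (L2_norm (\<Omega> t) (\<lambda>x. curl u x t))\<^sup>2"

definition enstrophy_rate :: "vector_field \<Rightarrow> (real \<Rightarrow> (real^3) set) \<Rightarrow> real \<Rightarrow> real" where
  "enstrophy_rate u \<Omega> t = - deriv (\<lambda>s. 1 / (2 * enstrophy u \<Omega> s)) t"

end

theory Submission
  imports Defs
begin

text \<open>
  The hypotheses ask \<open>u\<close> and \<open>p\<close> to be of class $C^2$ on the whole half space \<open>UNIV \<times> {0..}\<close>.
  Such a flow cannot satisfy the condition on \<open>\<lambda>\<close> and have a growing enstrophy: the two contradict
  each other, which is how a finite life span shows up for a solution that is assumed smooth for
  all times. So the proof derives \<open>enstrophy_rate u \<Omega> t0 \<le> 0\<close> (\<open>enstrophy_rate_nonpos\<close>).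

  Follow one particle and write \<open>W\<close> for the vorticity it carries. The Euler equations give
  \<open>W' = S W\<close> and \<open>W'' = - P W = \<lambda> W\<close> (\<open>vorticity_along_trajectory\<close>). The strain \<open>S\<close> is symmetric, so
  $|W'|^2 \le \mu_m^2 |W|^2$ (\<open>norm_symmetric_mult_le\<close>). With $N = |W|^2$ one has
  $N'' = 2|W'|^2 + 2\lambda N$ and $N'^2 \le 4 N |W'|^2$, hence where $N > 0$
  \[ \left(\frac1N\right)'' = \frac{2 N'^2 - N N''}{N^3} \le \frac{6|W'|^2 - 2\lambda N}{N^2}
     \le \frac{6\mu_m^2 - 2\lambda}{N} \le 0 . \]
  A concave function that stays positive on an infinite time interval cannot decrease. This is the
  classical estimate for the reciprocal of the enstrophy, applied to each particle separately
  (\<open>concave_reciprocal_no_growth\<close>): from time \<open>t0\<close> on, no particle has \<open>N' > 0\<close>.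

  The enstrophy of the material volume is the integral of \<open>N\<close> over the particles, because the flow
  map preserves volume, and its derivative is the integral of \<open>N'\<close>
  (\<open>enstrophy_material_derivative\<close>). That requires the flow map to be injective, differentiable in
  the starting point, and of Jacobian determinant 1. All this rests on the $C^1$ regularity of the
  velocity in space: differences of trajectories obey Gronwall's inequality, so the difference
  quotients in the starting point converge to solutions of the variational equation
  \<open>Y' = (\<nabla>u) Y\<close> (\<open>flow_derivative\<close>), whose determinant is constant as \<open>\<nabla>u\<close> has trace 0
  (\<open>liouville_3\<close>).
\<close>


section \<open>Gronwall's inequality and matrix norms\<close>

text \<open>
  Working with the squared norm avoids differentiating the norm where \<open>f\<close> vanishes. Since
  \<open>2 \<epsilon> \<bar>f\<bar> \<le> \<epsilon>\<^sup>2 + \<bar>f\<bar>\<^sup>2\<close>, the inhomogeneity costs only the \<open>+ 1\<close> in the exponent, and it enters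
  the bound as \<open>\<epsilon>\<^sup>2\<close>, so that an error of size \<open>o(1)\<close> in the equation stays \<open>o(1)\<close> in the solution.
\<close>

lemma gronwall_norm_square:
  fixes f :: "real \<Rightarrow> 'a::real_inner"
  assumes der: "\<And>t. t \<in> {0..T} \<Longrightarrow> (f has_vector_derivative f' t) (at t within {0..T})"
    and bound: "\<And>t. t \<in> {0..T} \<Longrightarrow> norm (f' t) \<le> L * norm (f t) + \<epsilon>"
    and L: "0 \<le> L" and t: "t \<in> {0..T}"
  shows "(norm (f t))\<^sup>2 \<le> ((norm (f 0))\<^sup>2 + \<epsilon>\<^sup>2 * t) * exp ((2 * L + 1) * t)"
proof -
  let ?c = "2 * L + 1"
  define \<phi> where "\<phi> = (\<lambda>s. (f s \<bullet> f s) * exp (- ?c * s) - \<epsilon>\<^sup>2 * s)"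
  define \<phi>' where "\<phi>' = (\<lambda>s. (2 * (f s \<bullet> f' s) - ?c * (f s \<bullet> f s)) * exp (- ?c * s) - \<epsilon>\<^sup>2)"
  have d: "(\<phi> has_real_derivative \<phi>' s) (at s within {0..t})" if "s \<in> {0..t}" for s
  proof -
    have "(f has_vector_derivative f' s) (at s within {0..t})"
      by (rule has_vector_derivative_within_subset[OF der]) (use that t in auto)
    then have "((\<lambda>s. f s \<bullet> f s) has_real_derivative 2 * (f s \<bullet> f' s)) (at s within {0..t})"
      unfolding has_vector_derivative_def has_field_derivative_def
      by (auto intro!: derivative_eq_intros simp: inner_commute algebra_simps fun_eq_iff)
    then show ?thesis
      unfolding \<phi>_def \<phi>'_def
      by (auto intro!: derivative_eq_intros simp: algebra_simps)
  qed
  have neg: "\<phi>' s \<le> 0" if s: "s \<in> {0..T}" for s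
  proof -
    have "2 * (f s \<bullet> f' s) \<le> 2 * (norm (f s) * norm (f' s))"
      using norm_cauchy_schwarz[of "f s" "f' s"] by simp
    also have "\<dots> \<le> 2 * (norm (f s) * (L * norm (f s) + \<epsilon>))"
      using bound[OF s] by (simp add: mult_left_mono)
    also have "\<dots> \<le> ?c * (norm (f s))\<^sup>2 + \<epsilon>\<^sup>2"
      using sum_squares_bound[of "norm (f s)" \<epsilon>] by (simp add: algebra_simps power2_eq_square)
    finally have *: "2 * (f s \<bullet> f' s) - ?c * (f s \<bullet> f s) \<le> \<epsilon>\<^sup>2"
      by (simp add: power2_norm_eq_inner)
    have "exp (- ?c * s) \<le> 1"
      using s L by (simp add: mult_nonpos_nonneg)
    then have "\<epsilon>\<^sup>2 * exp (- ?c * s) \<le> \<epsilon>\<^sup>2 * 1"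
      by (intro mult_left_mono) auto
    moreover have "(2 * (f s \<bullet> f' s) - ?c * (f s \<bullet> f s)) * exp (- ?c * s) \<le> \<epsilon>\<^sup>2 * exp (- ?c * s)"
      by (intro mult_right_mono *) auto
    ultimately show ?thesis unfolding \<phi>'_def by linarith
  qed
  have "\<exists>s\<in>{0..t}. \<phi> t - \<phi> 0 = \<phi>' s * (t - 0)"
    by (rule mvt_very_simple[of 0 t \<phi> "\<lambda>s. (*) (\<phi>' s)"])
      (use d t in \<open>auto simp: has_field_derivative_def\<close>)
  then obtain s where "s \<in> {0..t}" and "\<phi> t - \<phi> 0 = \<phi>' s * t"
    by auto
  then have "\<phi> t \<le> \<phi> 0"
    using neg[of s] t mult_nonpos_nonneg[of "\<phi>' s" t] by auto
  then have "(f t \<bullet> f t) * exp (- ?c * t) \<le> f 0 \<bullet> f 0 + \<epsilon>\<^sup>2 * t"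
    by (simp add: \<phi>_def)
  then have "((f t \<bullet> f t) * exp (- ?c * t)) * exp (?c * t) \<le> (f 0 \<bullet> f 0 + \<epsilon>\<^sup>2 * t) * exp (?c * t)"
    by (rule mult_right_mono) simp
  moreover have "((f t \<bullet> f t) * exp (- ?c * t)) * exp (?c * t) = f t \<bullet> f t"
    by (simp add: mult.assoc exp_add[symmetric] algebra_simps)
  ultimately show ?thesis
    by (simp only: power2_norm_eq_inner)
qed

lemma gronwall_norm:
  fixes f :: "real \<Rightarrow> 'a::real_inner"
  assumes der: "\<And>t. t \<in> {0..T} \<Longrightarrow> (f has_vector_derivative f' t) (at t within {0..T})"
    and bound: "\<And>t. t \<in> {0..T} \<Longrightarrow> norm (f' t) \<le> L * norm (f t)"
    and L: "0 \<le> L" and t: "t \<in> {0..T}"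
  shows "norm (f t) \<le> norm (f 0) * exp ((L + 1) * t)"
proof -
  have "(norm (f t))\<^sup>2 \<le> ((norm (f 0))\<^sup>2 + 0\<^sup>2 * t) * exp ((2 * L + 1) * t)"
    by (rule gronwall_norm_square[OF der _ L t]) (use bound in auto)
  also have "\<dots> \<le> (norm (f 0))\<^sup>2 * exp (2 * ((L + 1) * t))"
    using t by (auto intro!: mult_left_mono simp: algebra_simps)
  also have "\<dots> = (norm (f 0) * exp ((L + 1) * t))\<^sup>2"
    by (simp add: power_mult_distrib exp_double)
  finally show ?thesis
    by (rule power2_le_imp_le) simp
qed

lemma norm_matrix_vector_mult_le:
  fixes A :: "real^'n^'m"
  shows "norm (A *v x) \<le> norm A * norm x"
proof -
  have "norm (A *v x) = L2_set (\<lambda>i. \<bar>A $ i \<bullet> x\<bar>) UNIV"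
    by (simp add: norm_vec_def matrix_mult_dot)
  also have "\<dots> \<le> L2_set (\<lambda>i. norm (A $ i) * norm x) UNIV"
    by (intro L2_set_mono) (auto simp: Cauchy_Schwarz_ineq2)
  also have "\<dots> = norm A * norm x"
    by (simp add: norm_vec_def[of A] L2_set_left_distrib)
  finally show ?thesis .
qed

lemma onorm_matrix_vector_mult_le: "onorm ((*v) (A :: real^'n^'m)) \<le> norm A"
  by (rule onorm_le) (rule norm_matrix_vector_mult_le)

section \<open>Trajectories of a time-dependent velocity field\<close>

text \<open>
  The trajectories of \<open>u\<close> that start in \<open>D\<close>. Continuity of the Jacobian matrix \<open>J\<close> down to time 0
  gives \<open>u\<close> a Lipschitz constant in space on bounded sets and bounded time intervals.
\<close>

locale flow =
  fixes u :: "real^'n \<Rightarrow> real \<Rightarrow> real^'n" and J :: "real^'n \<Rightarrow> real \<Rightarrow> real^'n^'n"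
    and D :: "(real^'n) set" and X :: "real^'n \<Rightarrow> real \<Rightarrow> real^'n"
  assumes jacobian: "0 \<le> t \<Longrightarrow> ((\<lambda>y. u y t) has_derivative (*v) (J x t)) (at x)"
    and continuous_jacobian: "continuous_on (UNIV \<times> {0..}) (\<lambda>(x, t). J x t)"
    and start: "a \<in> D \<Longrightarrow> X a 0 = a"
    and trajectory: "a \<in> D \<Longrightarrow> 0 \<le> t \<Longrightarrow>
      (X a has_vector_derivative u (X a t) t) (at t within {0..})"
begin

lemma trajectory_within:
  assumes "a \<in> D" "t \<in> {0..T}"
  shows "(X a has_vector_derivative u (X a t) t) (at t within {0..T})"
  by (rule has_vector_derivative_within_subset[OF trajectory]) (use assms in auto)

lemma continuous_trajectory: "a \<in> D \<Longrightarrow> continuous_on {0..} (X a)"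
  by (rule continuous_on_vector_derivative) (use trajectory in auto)

lemma trajectory_bounded:
  assumes "a \<in> D"
  obtains R where "0 \<le> R" "\<And>t. t \<in> {0..T} \<Longrightarrow> norm (X a t) \<le> R"
proof -
  have "continuous_on {0..T} (X a)"
    by (rule continuous_on_subset[OF continuous_trajectory[OF assms]]) auto
  then have "bounded (X a ` {0..T})"
    by (intro compact_imp_bounded compact_continuous_image) auto
  then obtain B where "\<forall>x\<in>X a ` {0..T}. norm x \<le> B"
    unfolding bounded_iff by blast
  then show thesis
    by (intro that[of "\<bar>B\<bar>"]) force+
qed

lemma locally_lipschitz:
  obtains L where "0 \<le> L" "\<And>x t. t \<in> {0..T} \<Longrightarrow> norm x \<le> R \<Longrightarrow> norm (J x t) \<le> L"
    "\<And>x y t. t \<in> {0..T} \<Longrightarrow> norm x \<le> R \<Longrightarrow> norm y \<le> R \<Longrightarrow> norm (u x t - u y t) \<le> L * norm (x - y)"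
proof -
  have "continuous_on (cball 0 R \<times> {0..T}) (\<lambda>(x, t). J x t)"
    by (rule continuous_on_subset[OF continuous_jacobian]) auto
  then have "bounded ((\<lambda>(x, t). J x t) ` (cball 0 R \<times> {0..T}))"
    by (intro compact_imp_bounded compact_continuous_image compact_Times) auto
  then obtain B where "\<forall>A\<in>(\<lambda>(x, t). J x t) ` (cball 0 R \<times> {0..T}). norm A \<le> B"
    unfolding bounded_iff by blast
  then have B: "norm (J x t) \<le> \<bar>B\<bar>" if "t \<in> {0..T}" "norm x \<le> R" for x t
    using that by force
  show thesis
  proof (rule that[of "\<bar>B\<bar>"])
    fix x y :: "real^'n" and t assume t: "t \<in> {0..T}" and xy: "norm x \<le> R" "norm y \<le> R"
    show "norm (u x t - u y t) \<le> \<bar>B\<bar> * norm (x - y)"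
    proof (rule differentiable_bound[of "cball 0 R" "\<lambda>x. u x t" "\<lambda>x. (*v) (J x t)"])
      fix z :: "real^'n" assume "z \<in> cball 0 R"
      then show "onorm ((*v) (J z t)) \<le> \<bar>B\<bar>"
        using order_trans[OF onorm_matrix_vector_mult_le B] t by auto
    qed (use t xy jacobian in \<open>auto intro: has_derivative_at_withinI\<close>)
  qed (use B in auto)
qed

text \<open>
  On bounded sets the Jacobian is uniformly continuous, and the mean value inequality turns its
  modulus of continuity into an error bound for the linearization of \<open>u\<close> that is uniform in the
  base point and in time.
\<close>

lemma uniform_linearization:
  assumes "0 < \<epsilon>"
  obtains \<delta> where "0 < \<delta>" "\<And>x y t. t \<in> {0..T} \<Longrightarrow> norm x \<le> R \<Longrightarrow> norm y \<le> R \<Longrightarrow> norm (y - x) < \<delta> \<Longrightarrow>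
    norm (u y t - u x t - J x t *v (y - x)) \<le> \<epsilon> * norm (y - x)"
proof -
  let ?K = "cball 0 R \<times> {0..T} :: ((real^'n) \<times> real) set"
  have "continuous_on ?K (\<lambda>(x, t). J x t)"
    by (rule continuous_on_subset[OF continuous_jacobian]) auto
  then have "uniformly_continuous_on ?K (\<lambda>(x, t). J x t)"
    by (intro compact_uniformly_continuous compact_Times) auto
  then obtain \<delta> where \<delta>: "0 < \<delta>"
    and unif: "\<And>p q. p \<in> ?K \<Longrightarrow> q \<in> ?K \<Longrightarrow> dist q p < \<delta> \<Longrightarrow>
      dist ((\<lambda>(x, t). J x t) q) ((\<lambda>(x, t). J x t) p) < \<epsilon>"
    unfolding uniformly_continuous_on_def using assms by metis
  show thesis
  proof (rule that[OF \<delta>])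
    fix x y :: "real^'n" and t assume t: "t \<in> {0..T}" and x: "norm x \<le> R" and y: "norm y \<le> R" and xy: "norm (y - x) < \<delta>"
    let ?S = "cball 0 R \<inter> ball x \<delta>"
    have "norm (u y t - u x t - J x t *v (y - x)) \<le> norm (y - x) * \<epsilon>"
    proof (rule differentiable_bound_linearization[of x y ?S "\<lambda>x. u x t" "\<lambda>x. (*v) (J x t)" x])
      fix s :: real assume s: "s \<in> {0..1}"
      have "closed_segment x y \<subseteq> ?S"
        using x y xy \<delta> by (intro closed_segment_subset convex_Int) (auto simp: dist_norm norm_minus_commute)
      moreover have "x + s *\<^sub>R (y - x) = (1 - s) *\<^sub>R x + s *\<^sub>R y"
        by (simp add: algebra_simps)
      ultimately show "x + s *\<^sub>R (y - x) \<in> ?S"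
        using s by (auto simp: closed_segment_def subset_iff)
    next
      fix z assume z: "z \<in> ?S"
      have "norm (J z t - J x t) \<le> \<epsilon>"
        using unif[of "(x, t)" "(z, t)"] z x t by (force simp: dist_norm dist_Pair_Pair norm_minus_commute)
      moreover have "(*v) (J z t) - (*v) (J x t) = (*v) (J z t - J x t)"
        by (auto simp: fun_eq_iff matrix_vector_mult_diff_rdistrib)
      ultimately show "onorm ((*v) (J z t) - (*v) (J x t)) \<le> \<epsilon>"
        using order_trans[OF onorm_matrix_vector_mult_le] by auto
    qed (use t x \<delta> jacobian in \<open>auto intro: has_derivative_at_withinI convex_Int\<close>)
    then show "norm (u y t - u x t - J x t *v (y - x)) \<le> \<epsilon> * norm (y - x)"
      by (simp add: mult.commute)
  qed
qed

lemma trajectories_separate_exponentially: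
  assumes "a \<in> D" "b \<in> D" "0 \<le> L" "t \<in> {0..T}"
    and lip: "\<And>s. s \<in> {0..T} \<Longrightarrow> norm (u (X b s) s - u (X a s) s) \<le> L * norm (X b s - X a s)"
  shows "norm (X b t - X a t) \<le> norm (b - a) * exp ((L + 1) * t)"
  using gronwall_norm[of T "\<lambda>s. X b s - X a s" "\<lambda>s. u (X b s) s - u (X a s) s" L t] assms
    has_vector_derivative_diff[OF trajectory_within trajectory_within]
  by (auto simp: start)

text \<open>
  A Lipschitz constant of \<open>u\<close> is available only on bounded sets. As long as a second trajectory
  stays within distance 1 of the one from \<open>a\<close>, Gronwall's inequality keeps it within distance
  \<open>C \<bar>b - a\<bar>\<close>, which is less than 1 for \<open>b\<close> close to \<open>a\<close>; so the first time at which the distance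
  equals 1 does not come before \<open>T\<close>.
\<close>

lemma trajectories_stay_close:
  assumes a: "a \<in> D" and T: "0 \<le> T"
  obtains \<delta> C R where "0 < \<delta>" "0 \<le> C"
    "\<And>b t. b \<in> D \<Longrightarrow> norm (b - a) < \<delta> \<Longrightarrow> t \<in> {0..T} \<Longrightarrow> norm (X b t) \<le> R"
    "\<And>b t. b \<in> D \<Longrightarrow> norm (b - a) < \<delta> \<Longrightarrow> t \<in> {0..T} \<Longrightarrow> norm (X b t - X a t) \<le> C * norm (b - a)"
proof -
  obtain R where R: "\<And>t. t \<in> {0..T} \<Longrightarrow> norm (X a t) \<le> R"
    using trajectory_bounded[OF a] by metis
  obtain L where L: "0 \<le> L" and lip: "\<And>x y t. t \<in> {0..T} \<Longrightarrow> norm x \<le> R + 1 \<Longrightarrow> norm y \<le> R + 1 \<Longrightarrow>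
      norm (u x t - u y t) \<le> L * norm (x - y)"
    using locally_lipschitz[of T "R + 1"] by metis
  let ?C = "exp ((L + 1) * T)"
  have est: "norm (X b t - X a t) \<le> ?C * norm (b - a)"
    if b: "b \<in> D" and t: "t \<in> {0..T}" and near: "\<And>s. s \<in> {0..t} \<Longrightarrow> norm (X b s - X a s) \<le> 1" for b t
  proof -
    have "norm (X b t - X a t) \<le> norm (b - a) * exp ((L + 1) * t)"
    proof (rule trajectories_separate_exponentially[OF a b L, of t t])
      fix s assume s: "s \<in> {0..t}"
      have "norm (X a s) \<le> R" using R s t by auto
      moreover have "norm (X b s) \<le> norm (X b s - X a s) + norm (X a s)"
        using norm_triangle_ineq[of "X b s - X a s" "X a s"] by simp
      ultimately show "norm (u (X b s) s - u (X a s) s) \<le> L * norm (X b s - X a s)"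
        using near[OF s] s t by (intro lip) auto
    qed (use t in auto)
    also have "\<dots> \<le> norm (b - a) * ?C"
      using t L by (intro mult_left_mono) (auto intro!: mult_left_mono)
    finally show ?thesis by (simp add: mult.commute)
  qed
  let ?\<delta> = "1 / (2 * ?C)"
  have near: "norm (X b t - X a t) \<le> 1" if b: "b \<in> D" and ba: "norm (b - a) < ?\<delta>" and t: "t \<in> {0..T}" for b t
  proof (rule ccontr)
    assume far: "\<not> ?thesis"
    let ?d = "\<lambda>s. norm (X b s - X a s)"
    have small: "?C * norm (b - a) < 1"
      using ba by (simp add: field_simps)
    have cont: "continuous_on {0..t} ?d"
      by (intro continuous_intros continuous_on_subset[OF continuous_trajectory] a b) auto
    have "?d 0 < 1"
      using ba small order.strict_trans1[of "norm (b - a)" "?C * norm (b - a)" 1] L T a b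
      by (simp add: start mult_le_cancel_right1)
    let ?S = "{s \<in> {0..t}. ?d s = 1}"
    have S: "compact ?S"
    proof -
      have "closed ?S"
        by (rule continuous_closed_preimage_constant[OF cont]) simp
      then show ?thesis
        by (metis (no_types, lifting) bounded_closed_interval bounded_subset compact_eq_bounded_closed mem_Collect_eq subsetI)
    qed
    have crosses: "\<exists>s\<in>?S. s \<le> r" if "r \<in> {0..t}" "1 \<le> ?d r" for r
      using IVT'[of ?d 0 1 r] \<open>?d 0 < 1\<close> that continuous_on_subset[OF cont, of "{0..r}"] by auto
    \<comment> \<open>\<open>?S\<close> is the set of times at distance exactly 1, and its minimum is the first exit time.\<close>
    then have "?S \<noteq> {}" using far t by force
    then obtain s where s: "s \<in> ?S" and least: "\<And>r. r \<in> ?S \<Longrightarrow> s \<le> r"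
      using compact_attains_inf[OF S] by blast
    have "?d r \<le> 1" if r: "r \<in> {0..s}" for r
    proof (rule ccontr)
      assume gt: "\<not> ?d r \<le> 1"
      then obtain q where "q \<in> ?S" "q \<le> r"
        using crosses[of r] r s by auto
      then have "r = s" using least[of q] r by auto
      with gt s show False by auto
    qed
    then have "?d s \<le> ?C * norm (b - a)"
      using s t by (intro est b) auto
    then show False using s small by auto
  qed
  show thesis
  proof (rule that[of ?\<delta> ?C "R + 1"])
    fix b t assume b: "b \<in> D" "norm (b - a) < ?\<delta>" "t \<in> {0..T}"
    show "norm (X b t) \<le> R + 1"
      using near[OF b] R[OF b(3)] norm_triangle_ineq[of "X b t - X a t" "X a t"] by simp
    show "norm (X b t - X a t) \<le> ?C * norm (b - a)"
      using b by (intro est near) auto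
  qed auto
qed


text \<open>
  Two trajectories that meet at time \<open>t\<close> are compared backwards in time, by Gronwall's inequality
  for the reversed flow started at the meeting point.
\<close>

lemma trajectories_inj:
  assumes a: "a \<in> D" and b: "b \<in> D" and t: "0 \<le> t" and eq: "X a t = X b t"
  shows "a = b"
proof -
  obtain Ra where Ra: "\<And>s. s \<in> {0..t} \<Longrightarrow> norm (X a s) \<le> Ra" using trajectory_bounded[OF a] by metis
  obtain Rb where Rb: "\<And>s. s \<in> {0..t} \<Longrightarrow> norm (X b s) \<le> Rb" using trajectory_bounded[OF b] by metis
  obtain L where L: "0 \<le> L" and lip: "\<And>x y s. s \<in> {0..t} \<Longrightarrow> norm x \<le> max Ra Rb \<Longrightarrow> norm y \<le> max Ra Rb \<Longrightarrow>
      norm (u x s - u y s) \<le> L * norm (x - y)"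
    using locally_lipschitz[of t "max Ra Rb"] by metis
  have rev: "((\<lambda>s. X c (t - s)) has_vector_derivative - u (X c (t - s)) (t - s)) (at s within {0..t})"
    if "c \<in> D" "s \<in> {0..t}" for c s
  proof -
    have "((\<lambda>s. t - s) has_vector_derivative -1) (at s within {0..t})"
      by (auto intro!: derivative_eq_intros simp: has_vector_derivative_def)
    moreover have "(X c has_vector_derivative u (X c (t - s)) (t - s)) (at (t - s) within (\<lambda>s. t - s) ` {0..t})"
      by (rule has_vector_derivative_within_subset[OF trajectory]) (use that in auto)
    ultimately show ?thesis
      by (auto dest: vector_diff_chain_within simp: o_def)
  qed
  have "norm (X a (t - t) - X b (t - t)) \<le> norm (X a (t - 0) - X b (t - 0)) * exp ((L + 1) * t)"
  proof (rule gronwall_norm[where f' = "\<lambda>s. - u (X a (t - s)) (t - s) - - u (X b (t - s)) (t - s)"])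
    fix s assume s: "s \<in> {0..t}"
    show "((\<lambda>s. X a (t - s) - X b (t - s)) has_vector_derivative
        - u (X a (t - s)) (t - s) - - u (X b (t - s)) (t - s)) (at s within {0..t})"
      by (intro has_vector_derivative_diff rev a b s)
    have "norm (X a (t - s)) \<le> max Ra Rb" "norm (X b (t - s)) \<le> max Ra Rb"
      using Ra[of "t - s"] Rb[of "t - s"] s by auto
    then show "norm (- u (X a (t - s)) (t - s) - - u (X b (t - s)) (t - s)) \<le> L * norm (X a (t - s) - X b (t - s))"
      using lip[of "t - s" "X a (t - s)" "X b (t - s)"] s by (simp add: norm_minus_commute)
  qed (use L t in auto)
  then show ?thesis
    using eq a b by (simp add: start)
qed

text \<open>
  Each starting point has a neighbourhood with a common bound; finitely many of them cover \<open>D\<close>.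
\<close>

lemma trajectories_uniformly_bounded:
  assumes D: "compact D" and T: "0 \<le> T"
  obtains R where "\<And>a t. a \<in> D \<Longrightarrow> t \<in> {0..T} \<Longrightarrow> norm (X a t) \<le> R"
proof -
  have "\<exists>\<delta> R. 0 < \<delta> \<and> (\<forall>b\<in>D. \<forall>t\<in>{0..T}. norm (b - a) < \<delta> \<longrightarrow> norm (X b t) \<le> R)" if "a \<in> D" for a
    by (rule trajectories_stay_close[OF that T]) blast
  then obtain \<delta> R where \<delta>: "\<And>a. a \<in> D \<Longrightarrow> 0 < \<delta> a"
    and R: "\<And>a b t. a \<in> D \<Longrightarrow> b \<in> D \<Longrightarrow> t \<in> {0..T} \<Longrightarrow> norm (b - a) < \<delta> a \<Longrightarrow> norm (X b t) \<le> R a"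
    by metis
  have "D \<subseteq> (\<Union>a\<in>D. ball a (\<delta> a))"
    using \<delta> by auto
  then obtain C where C: "C \<subseteq> D" "finite C" "D \<subseteq> (\<Union>a\<in>C. ball a (\<delta> a))"
    using compactE_image[OF D, of D "\<lambda>a. ball a (\<delta> a)"] by blast
  show thesis
  proof (rule that)
    fix b t assume b: "b \<in> D" and t: "t \<in> {0..T}"
    then obtain a where a: "a \<in> C" "b \<in> ball a (\<delta> a)" using C by auto
    then have "norm (X b t) \<le> R a"
      using C(1) b t by (intro R) (auto simp: dist_norm norm_minus_commute)
    also have "\<dots> \<le> Max (R ` C)"
      using a C(2) by auto
    finally show "norm (X b t) \<le> Max (R ` C)" .
  qed
qed

end

section \<open>Differentiability of the flow map and Liouville's formula\<close>

text \<open>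
  Approximate solutions of a linear equation with a common initial value form a uniform Cauchy
  sequence, and their limit solves the equation. This is how solutions of the variational equation
  are obtained below, with the difference quotients of the flow as approximations.
\<close>

lemma linear_ode_limit:
  fixes A :: "real \<Rightarrow> real^'n^'n" and f :: "nat \<Rightarrow> real \<Rightarrow> real^'n"
  assumes T: "0 \<le> T" and L: "\<And>t. t \<in> {0..T} \<Longrightarrow> norm (A t) \<le> L"
    and der: "\<And>n t. t \<in> {0..T} \<Longrightarrow> (f n has_vector_derivative f' n t) (at t within {0..T})"
    and init: "\<And>n. f n 0 = v"
    and err: "\<And>\<epsilon>. 0 < \<epsilon> \<Longrightarrow> \<forall>\<^sub>F n in sequentially. \<forall>t\<in>{0..T}. norm (f' n t - A t *v f n t) \<le> \<epsilon>"
  obtains Y where "Y 0 = v" "\<And>t. t \<in> {0..T} \<Longrightarrow> (Y has_vector_derivative A t *v Y t) (at t within {0..T})"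
proof -
  have L0: "0 \<le> L" using order_trans[OF norm_ge_zero L[of 0]] T by simp
  have A: "norm (A t *v x) \<le> L * norm x" if "t \<in> {0..T}" for t x
    using order_trans[OF norm_matrix_vector_mult_le mult_right_mono[OF L[OF that]]] by auto
  define K where "K = sqrt ((T + 1) * exp ((2 * L + 1) * T))"
  have K: "0 < K" "K\<^sup>2 = (T + 1) * exp ((2 * L + 1) * T)"
    using T by (auto simp: K_def)
  have cauchy: "\<exists>M. \<forall>t\<in>{0..T}. \<forall>m\<ge>M. \<forall>n\<ge>M. dist (f m t) (f n t) < e" if e: "0 < e" for e
  proof -
    define \<epsilon> where "\<epsilon> = e / (4 * K)"
    have "0 < \<epsilon>" using e K by (simp add: \<epsilon>_def)
    then obtain M where M: "\<And>n t. M \<le> n \<Longrightarrow> t \<in> {0..T} \<Longrightarrow> norm (f' n t - A t *v f n t) \<le> \<epsilon>"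
      using err[OF \<open>0 < \<epsilon>\<close>] unfolding eventually_sequentially by blast
    have "dist (f m t) (f n t) < e" if t: "t \<in> {0..T}" and mn: "M \<le> m" "M \<le> n" for t m n
    proof -
      have "(norm (f m t - f n t))\<^sup>2 \<le> ((norm (f m 0 - f n 0))\<^sup>2 + (2 * \<epsilon>)\<^sup>2 * t) * exp ((2 * L + 1) * t)"
      proof (rule gronwall_norm_square[where f' = "\<lambda>t. f' m t - f' n t"])
        fix s assume s: "s \<in> {0..T}"
        show "((\<lambda>t. f m t - f n t) has_vector_derivative f' m s - f' n s) (at s within {0..T})"
          by (intro has_vector_derivative_diff der s)
        have "f' m s - f' n s = A s *v (f m s - f n s) + (f' m s - A s *v f m s) - (f' n s - A s *v f n s)"
          by (simp add: matrix_vector_mult_diff_distrib)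
        also have "norm \<dots> \<le> norm (A s *v (f m s - f n s)) + norm (f' m s - A s *v f m s) + norm (f' n s - A s *v f n s)"
          by (meson add_mono norm_triangle_ineq norm_triangle_ineq4 order_refl order_trans)
        finally show "norm (f' m s - f' n s) \<le> L * norm (f m s - f n s) + 2 * \<epsilon>"
          using M[OF mn(1) s] M[OF mn(2) s] A[OF s, of "f m s - f n s"] by linarith
      qed (use L0 t in auto)
      also have "\<dots> \<le> ((2 * \<epsilon>)\<^sup>2 * (T + 1)) * exp ((2 * L + 1) * T)"
        using t L0 by (auto simp: init intro!: mult_mono)
      also have "\<dots> = (2 * \<epsilon> * K)\<^sup>2"
        by (simp add: K(2) power_mult_distrib)
      finally have "norm (f m t - f n t) \<le> 2 * \<epsilon> * K"
        by (rule power2_le_imp_le) (use K \<open>0 < \<epsilon>\<close> in auto)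
      also have "\<dots> < e" using K e by (simp add: \<epsilon>_def)
      finally show ?thesis by (simp add: dist_norm)
    qed
    then show ?thesis by blast
  qed
  then have "uniformly_Cauchy_on {0..T} f"
    by (rule uniformly_Cauchy_onI)
  then obtain Y where Y: "uniform_limit {0..T} f Y sequentially"
    using Cauchy_uniformly_convergent uniformly_convergent_on_def by blast
  have lim: "(\<lambda>n. f n t) \<longlonglongrightarrow> Y t" if "t \<in> {0..T}" for t
    using tendsto_uniform_limitI[OF Y that] .
  have conv: "\<forall>\<^sub>F n in sequentially. \<forall>t\<in>{0..T}. \<forall>h. norm (h *\<^sub>R f' n t - h *\<^sub>R (A t *v Y t)) \<le> e * norm h"
    if e: "0 < e" for e
  proof -
    have "\<forall>\<^sub>F n in sequentially. \<forall>t\<in>{0..T}. dist (f n t) (Y t) < e / (2 * (L + 1))"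
      using uniform_limitD[OF Y, of "e / (2 * (L + 1))"] e L0 by auto
    moreover have "\<forall>\<^sub>F n in sequentially. \<forall>t\<in>{0..T}. norm (f' n t - A t *v f n t) \<le> e / 2"
      using e by (intro err) auto
    ultimately show "\<forall>\<^sub>F n in sequentially. \<forall>t\<in>{0..T}. \<forall>h. norm (h *\<^sub>R f' n t - h *\<^sub>R (A t *v Y t)) \<le> e * norm h"
    proof eventually_elim
      case (elim n)
      show ?case
      proof (intro ballI allI)
        fix t h assume t: "t \<in> {0..T}"
        have "norm (A t *v (f n t - Y t)) \<le> L * norm (f n t - Y t)" by (rule A[OF t])
        also have "\<dots> \<le> L * (e / (2 * (L + 1)))"
          using elim(1) t L0 by (intro mult_left_mono) (auto simp: dist_norm less_imp_le)
        also have "\<dots> \<le> e / 2"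
          using L0 e by (simp add: field_simps)
        finally have "norm (A t *v (f n t - Y t)) \<le> e / 2" .
        moreover have "f' n t - A t *v Y t = (f' n t - A t *v f n t) + A t *v (f n t - Y t)"
          by (simp add: matrix_vector_mult_diff_distrib)
        then have "norm (f' n t - A t *v Y t) \<le> norm (f' n t - A t *v f n t) + norm (A t *v (f n t - Y t))"
          by (metis norm_triangle_ineq)
        ultimately have "norm (f' n t - A t *v Y t) \<le> e"
          using bspec[OF elim(2) t] by linarith
        then show "norm (h *\<^sub>R f' n t - h *\<^sub>R (A t *v Y t)) \<le> e * norm h"
          by (metis mult.commute mult_right_mono norm_ge_zero norm_scaleR real_norm_def scaleR_diff_right)
      qed
    qed
  qed
  have "\<exists>g. \<forall>t\<in>{0..T}. (\<lambda>n. f n t) \<longlonglongrightarrow> g t \<and> (g has_derivative (\<lambda>h. h *\<^sub>R (A t *v Y t))) (at t within {0..T})"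
    by (rule has_derivative_sequence[where f' = "\<lambda>n t h. h *\<^sub>R f' n t" and ?x0.0 = 0 and l = v])
      (use T der conv init in \<open>auto simp: has_vector_derivative_def\<close>)
  then obtain g where g: "\<And>t. t \<in> {0..T} \<Longrightarrow> (\<lambda>n. f n t) \<longlonglongrightarrow> g t"
    and dg: "\<And>t. t \<in> {0..T} \<Longrightarrow> (g has_vector_derivative A t *v Y t) (at t within {0..T})"
    unfolding has_vector_derivative_def by blast
  have "g t = Y t" if "t \<in> {0..T}" for t
    using LIMSEQ_unique[OF g lim] that by blast
  then show thesis
    using that[of g] dg LIMSEQ_unique[OF g[of 0], of v] T init by auto
qed

text \<open>
  The derivative of the determinant of the matrix with columns \<open>Y j t\<close> is \<open>trace (B t)\<close> times the
  determinant.
\<close>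

lemma liouville_3:
  fixes Y :: "3 \<Rightarrow> real \<Rightarrow> real^3"
  assumes der: "\<And>j t. t \<in> {0..T} \<Longrightarrow> (Y j has_vector_derivative B t *v Y j t) (at t within {0..T})"
    and trace: "\<And>t. t \<in> {0..T} \<Longrightarrow> trace (B t) = 0" and t: "t \<in> {0..T}"
  shows "det (\<chi> i j. Y j t $ i) = det (\<chi> i j. Y j 0 $ i)"
proof -
  have c: "((\<lambda>t. Y j t $ i) has_real_derivative (B s *v Y j s) $ i) (at s within {0..T})"
    if "s \<in> {0..T}" for i j s
    using bounded_linear.has_vector_derivative[OF bounded_linear_vec_nth der[OF that]]
    by (simp add: has_real_derivative_iff_has_vector_derivative)
  have "((\<lambda>t. det (\<chi> i j. Y j t $ i)) has_real_derivative 0) (at s within {0..T})" if s: "s \<in> {0..T}" for s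
  proof -
    have tr: "B s $ 3 $ 3 = - B s $ 1 $ 1 - B s $ 2 $ 2"
      using trace[OF s] by (simp add: trace_def sum_3)
    show ?thesis
      unfolding det_3
      by (auto intro!: derivative_eq_intros c[OF s] simp: matrix_vector_mult_def sum_3 tr algebra_simps)
  qed
  then have "\<exists>c. \<forall>s\<in>{0..T}. det (\<chi> i j. Y j s $ i) = c"
    by (intro has_derivative_zero_constant) (auto simp: has_field_derivative_def lambda_zero)
  then show ?thesis using t by fastforce
qed

context flow
begin

text \<open>
  The columns \<open>Y j\<close> of the derivative are the limits of the difference quotients
  \<open>(X (a + h e\<^sub>j) t - X a t) / h\<close>. Once they are known to solve the variational equation, Gronwall's
  inequality for \<open>X b t - X a t - Y t (b - a)\<close> turns these directional derivatives into a total one.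
\<close>

lemma flow_derivative:
  assumes a: "a \<in> interior D" and T: "0 \<le> T"
  obtains Y where "\<And>j. Y j 0 = axis j 1"
    "\<And>j t. t \<in> {0..T} \<Longrightarrow> (Y j has_vector_derivative J (X a t) t *v Y j t) (at t within {0..T})"
    "\<And>t. t \<in> {0..T} \<Longrightarrow> ((\<lambda>b. X b t) has_derivative (\<lambda>w. \<Sum>j\<in>UNIV. w $ j *\<^sub>R Y j t)) (at a)"
proof -
  obtain r where r: "0 < r" "ball a r \<subseteq> D"
    using a by (auto simp: mem_interior)
  then have aD: "a \<in> D" by auto
  obtain \<delta> C R where \<delta>: "0 < \<delta>" and C: "0 \<le> C"
    and R: "\<And>b t. b \<in> D \<Longrightarrow> norm (b - a) < \<delta> \<Longrightarrow> t \<in> {0..T} \<Longrightarrow> norm (X b t) \<le> R"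
    and close: "\<And>b t. b \<in> D \<Longrightarrow> norm (b - a) < \<delta> \<Longrightarrow> t \<in> {0..T} \<Longrightarrow> norm (X b t - X a t) \<le> C * norm (b - a)"
    using trajectories_stay_close[OF aD T] by metis
  obtain L where L: "0 \<le> L" "\<And>x t. t \<in> {0..T} \<Longrightarrow> norm x \<le> R \<Longrightarrow> norm (J x t) \<le> L"
    using locally_lipschitz[of T R] by metis
  have JL: "norm (J (X a t) t) \<le> L" if "t \<in> {0..T}" for t
    using L(2) R[OF aD] that \<delta> by auto
  \<comment> \<open>Both uses below need the linearization error relative to \<open>b - a\<close>, the distance of the starting
    points, rather than to the distance of the trajectories at time \<open>t\<close>.\<close>
  have linearized: "\<exists>\<eta>>0. \<forall>b\<in>D. norm (b - a) < \<eta> \<longrightarrow> (\<forall>t\<in>{0..T}.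
      norm (u (X b t) t - u (X a t) t - J (X a t) t *v (X b t - X a t)) \<le> \<epsilon> * norm (b - a))"
    if \<epsilon>: "0 < \<epsilon>" for \<epsilon>
  proof -
    obtain d where d: "0 < d" and lin: "\<And>x y t. t \<in> {0..T} \<Longrightarrow> norm x \<le> R \<Longrightarrow> norm y \<le> R \<Longrightarrow> norm (y - x) < d \<Longrightarrow>
        norm (u y t - u x t - J x t *v (y - x)) \<le> (\<epsilon> / (C + 1)) * norm (y - x)"
      using uniform_linearization[of "\<epsilon> / (C + 1)" T R] \<epsilon> C by (metis add_nonneg_pos divide_pos_pos zero_less_one)
    show ?thesis
    proof (intro exI[of _ "min \<delta> (d / (C + 1))"] conjI ballI impI)
      show "0 < min \<delta> (d / (C + 1))" using \<delta> d C by auto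
      fix b t assume b: "b \<in> D" "norm (b - a) < min \<delta> (d / (C + 1))" and t: "t \<in> {0..T}"
      have cl: "norm (X b t - X a t) \<le> C * norm (b - a)" using close b t by auto
      have "C * norm (b - a) \<le> (C + 1) * norm (b - a)" by (simp add: algebra_simps)
      also have "\<dots> < d" using b C by (simp add: field_simps)
      finally have "norm (X b t - X a t) < d" using cl by linarith
      then have "norm (u (X b t) t - u (X a t) t - J (X a t) t *v (X b t - X a t)) \<le> (\<epsilon> / (C + 1)) * norm (X b t - X a t)"
        using R aD b \<delta> t by (intro lin) auto
      also have "\<dots> \<le> (\<epsilon> / (C + 1)) * (C * norm (b - a))"
        using cl \<epsilon> C by (intro mult_left_mono) auto
      also have "\<dots> = (\<epsilon> * norm (b - a)) * (C / (C + 1))" by simp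
      also have "\<dots> \<le> (\<epsilon> * norm (b - a)) * 1"
        using C \<epsilon> by (intro mult_left_mono) auto
      finally show "norm (u (X b t) t - u (X a t) t - J (X a t) t *v (X b t - X a t)) \<le> \<epsilon> * norm (b - a)" by simp
    qed
  qed
  have "\<exists>Y. Y 0 = axis j 1 \<and> (\<forall>t\<in>{0..T}. (Y has_vector_derivative J (X a t) t *v Y t) (at t within {0..T}))" for j
  proof -
    \<comment> \<open>The step tends to 0 and stays below \<open>r\<close>, so that the displaced points lie in \<open>D\<close>.\<close>
    define h where "h = (\<lambda>n. r / 2 * inverse (real (Suc n)))"
    have h: "0 < h n" "h n < r" for n
    proof -
      show "0 < h n" using r by (simp add: h_def)
      have "inverse (real (Suc n)) \<le> 1" by (simp add: inverse_le_1_iff)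
      then have "h n \<le> r / 2 * 1" unfolding h_def using r by (intro mult_left_mono) auto
      then show "h n < r" using r by simp
    qed
    have h0: "h \<longlonglongrightarrow> 0"
      unfolding h_def by (intro tendsto_mult_right_zero LIMSEQ_inverse_real_of_nat)
    let ?b = "\<lambda>n. a + h n *\<^sub>R axis j 1"
    have b: "?b n \<in> D" and nb: "norm (?b n - a) = h n" for n
      using h[of n] r by (auto simp: dist_norm intro!: subsetD[OF r(2)])
    show ?thesis
    proof (rule linear_ode_limit[where A = "\<lambda>t. J (X a t) t" and v = "axis j 1" and T = T and L = L
          and f = "\<lambda>n t. (1 / h n) *\<^sub>R (X (?b n) t - X a t)"
          and f' = "\<lambda>n t. (1 / h n) *\<^sub>R (u (X (?b n) t) t - u (X a t) t)"])
      fix n t assume t: "t \<in> {0..T}"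
      show "((\<lambda>t. (1 / h n) *\<^sub>R (X (?b n) t - X a t)) has_vector_derivative
          (1 / h n) *\<^sub>R (u (X (?b n) t) t - u (X a t) t)) (at t within {0..T})"
        using bounded_linear.has_vector_derivative[OF bounded_linear_scaleR_right
            has_vector_derivative_diff[OF trajectory_within[OF b t] trajectory_within[OF aD t]]] .
    next
      fix n show "(1 / h n) *\<^sub>R (X (?b n) 0 - X a 0) = axis j 1"
        using start[OF b, of n] start[OF aD] h(1)[of n] by simp
    next
      fix \<epsilon> :: real assume "0 < \<epsilon>"
      from linearized[OF this] obtain \<eta> where \<eta>: "0 < \<eta>"
        and lin: "\<And>b t. b \<in> D \<Longrightarrow> norm (b - a) < \<eta> \<Longrightarrow> t \<in> {0..T} \<Longrightarrow>
          norm (u (X b t) t - u (X a t) t - J (X a t) t *v (X b t - X a t)) \<le> \<epsilon> * norm (b - a)"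
        by blast
      have "\<forall>\<^sub>F n in sequentially. h n < \<eta>"
        using order_tendstoD(2)[OF h0 \<eta>] .
      then show "\<forall>\<^sub>F n in sequentially. \<forall>t\<in>{0..T}.
          norm ((1 / h n) *\<^sub>R (u (X (?b n) t) t - u (X a t) t) -
            J (X a t) t *v ((1 / h n) *\<^sub>R (X (?b n) t - X a t))) \<le> \<epsilon>"
      proof eventually_elim
        case (elim n)
        show ?case
        proof
          fix t assume t: "t \<in> {0..T}"
          have "norm ((1 / h n) *\<^sub>R (u (X (?b n) t) t - u (X a t) t) -
              J (X a t) t *v ((1 / h n) *\<^sub>R (X (?b n) t - X a t)))
            = (1 / h n) * norm (u (X (?b n) t) t - u (X a t) t - J (X a t) t *v (X (?b n) t - X a t))"
            using h(1)[of n] by (simp add: matrix_vector_mult_scaleR flip: scaleR_diff_right)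
          also have "\<dots> \<le> (1 / h n) * (\<epsilon> * norm (?b n - a))"
            using h(1)[of n] elim nb[of n] by (intro mult_left_mono lin b t) auto
          also have "\<dots> = \<epsilon>" using h(1)[of n] nb[of n] by simp
          finally show "norm ((1 / h n) *\<^sub>R (u (X (?b n) t) t - u (X a t) t) -
              J (X a t) t *v ((1 / h n) *\<^sub>R (X (?b n) t - X a t))) \<le> \<epsilon>" .
        qed
      qed
    qed (use T JL in auto)
  qed
  then obtain Y where Y0: "\<And>j. Y j 0 = axis j 1"
    and dY: "\<And>j t. t \<in> {0..T} \<Longrightarrow> (Y j has_vector_derivative J (X a t) t *v Y j t) (at t within {0..T})"
    by metis
  let ?M = "\<lambda>t w. \<Sum>j\<in>UNIV. w $ j *\<^sub>R Y j t"
  have dM: "((\<lambda>t. ?M t w) has_vector_derivative J (X a t) t *v ?M t w) (at t within {0..T})"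
    if t: "t \<in> {0..T}" for t w
  proof -
    have "((\<lambda>t. ?M t w) has_vector_derivative (\<Sum>j\<in>UNIV. w $ j *\<^sub>R (J (X a t) t *v Y j t))) (at t within {0..T})"
      by (intro has_vector_derivative_sum bounded_linear.has_vector_derivative[OF bounded_linear_scaleR_right] dY t)
    then show ?thesis
      by (simp add: matrix_vector_mult_scaleR linear_sum[OF matrix_vector_mul_linear])
  qed
  have M0: "?M 0 w = w" for w
    by (simp add: Y0 vec_eq_iff axis_def if_distrib cong: if_cong)
  define K where "K = sqrt ((T + 1) * exp ((2 * L + 1) * T))"
  have K: "0 < K" "K\<^sup>2 = (T + 1) * exp ((2 * L + 1) * T)"
    using T by (auto simp: K_def)
  have "((\<lambda>b. X b t) has_derivative ?M t) (at a)" if t: "t \<in> {0..T}" for t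
    unfolding has_derivative_at_alt
  proof (intro conjI allI impI)
    show "bounded_linear (?M t)"
      by (intro bounded_linear_sum bounded_linear_compose[OF bounded_linear_scaleR_left bounded_linear_vec_nth])
    fix e :: real assume e: "0 < e"
    then have "0 < e / K" using K by simp
    from linearized[OF this] obtain \<eta> where \<eta>: "0 < \<eta>"
      and lin: "\<And>b t. b \<in> D \<Longrightarrow> norm (b - a) < \<eta> \<Longrightarrow> t \<in> {0..T} \<Longrightarrow>
        norm (u (X b t) t - u (X a t) t - J (X a t) t *v (X b t - X a t)) \<le> e / K * norm (b - a)"
      by blast
    show "\<exists>d>0. \<forall>b. norm (b - a) < d \<longrightarrow> norm (X b t - X a t - ?M t (b - a)) \<le> e * norm (b - a)"
    proof (intro exI[of _ "min \<eta> r"] conjI allI impI)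
      show "0 < min \<eta> r" using \<eta> r by simp
      fix b assume b: "norm (b - a) < min \<eta> r"
      have bD: "b \<in> D" using b r by (auto simp: dist_norm norm_minus_commute)
      have "(norm (X b t - X a t - ?M t (b - a)))\<^sup>2
          \<le> ((norm (X b 0 - X a 0 - ?M 0 (b - a)))\<^sup>2 + (e / K * norm (b - a))\<^sup>2 * t) * exp ((2 * L + 1) * t)"
      proof (rule gronwall_norm_square[where f' = "\<lambda>t. u (X b t) t - u (X a t) t - J (X a t) t *v ?M t (b - a)"])
        fix s assume s: "s \<in> {0..T}"
        show "((\<lambda>t. X b t - X a t - ?M t (b - a)) has_vector_derivative
            u (X b s) s - u (X a s) s - J (X a s) s *v ?M s (b - a)) (at s within {0..T})"
          by (intro has_vector_derivative_diff trajectory_within dM aD bD s)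
        have "u (X b s) s - u (X a s) s - J (X a s) s *v ?M s (b - a)
            = J (X a s) s *v (X b s - X a s - ?M s (b - a))
              + (u (X b s) s - u (X a s) s - J (X a s) s *v (X b s - X a s))"
          by (simp add: matrix_vector_mult_diff_distrib)
        also have "norm \<dots> \<le> norm (J (X a s) s) * norm (X b s - X a s - ?M s (b - a)) + e / K * norm (b - a)"
          by (intro norm_triangle_mono norm_matrix_vector_mult_le lin bD s) (use b in auto)
        also have "\<dots> \<le> L * norm (X b s - X a s - ?M s (b - a)) + e / K * norm (b - a)"
          by (intro add_right_mono mult_right_mono JL s) auto
        finally show "norm (u (X b s) s - u (X a s) s - J (X a s) s *v ?M s (b - a))
          \<le> L * norm (X b s - X a s - ?M s (b - a)) + e / K * norm (b - a)" .
      qed (use L t in auto)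
      also have "\<dots> = ((e / K * norm (b - a))\<^sup>2 * t) * exp ((2 * L + 1) * t)"
        by (simp only: M0 start[OF aD] start[OF bD]) simp
      also have "\<dots> \<le> ((e / K * norm (b - a))\<^sup>2 * (T + 1)) * exp ((2 * L + 1) * T)"
        using t L(1) by (intro mult_mono) auto
      also have "\<dots> = (e / K * norm (b - a))\<^sup>2 * K\<^sup>2"
        by (simp add: K(2))
      also have "\<dots> = (e * norm (b - a))\<^sup>2"
        using K(1) by (simp add: power_mult_distrib power_divide)
      finally show "norm (X b t - X a t - ?M t (b - a)) \<le> e * norm (b - a)"
        by (rule power2_le_imp_le) (use e in auto)
    qed
  qed
  then show thesis using that Y0 dY by blast
qed

end

section \<open>Volume preservation and differentiation under the integral\<close>

lemma set_integrable_bounded_continuous: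
  fixes f :: "'a::euclidean_space \<Rightarrow> real"
  assumes S: "open S" "bounded S" and f: "continuous_on S f" "\<And>x. x \<in> S \<Longrightarrow> \<bar>f x\<bar> \<le> B"
  shows "set_integrable lebesgue S f"
proof (rule set_integrable_bound)
  have "S \<in> lmeasurable" using S by (simp add: lmeasurable_open)
  then show "set_integrable lebesgue S (\<lambda>_. B)"
    by (auto simp: set_integrable_def fmeasurable_def intro!: integrable_real_indicator)
  have "(\<lambda>x. indicator S x *\<^sub>R f x) \<in> borel_measurable borel"
    using S f by (intro borel_measurable_continuous_on_indicator) auto
  then show "set_borel_measurable lebesgue S f"
    unfolding set_borel_measurable_def using measurable_completion[of _ lborel] by simp
qed (use f(2) in \<open>auto intro: order_trans[OF _ abs_ge_self]\<close>)

text \<open>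
  The change of variables theorem for vector-valued integrands, applied to the integrand as a
  vector with one component.
\<close>

lemma integral_volume_preserving:
  fixes g :: "real^'n::{finite,wellorder} \<Rightarrow> real^'n::_" and f :: "real^'n::_ \<Rightarrow> real"
  assumes S: "S \<in> sets lebesgue" and g: "\<And>x. x \<in> S \<Longrightarrow> (g has_derivative g' x) (at x within S)"
    and inj: "inj_on g S" and det: "\<And>x. x \<in> S \<Longrightarrow> \<bar>det (matrix (g' x))\<bar> = 1"
    and int: "set_integrable lebesgue S (\<lambda>x. f (g x))"
  shows "(LINT x:g ` S|lebesgue. f x) = (LINT x:S|lebesgue. f (g x))"
proof -
  define F where "F = (\<lambda>x. vec (f x) :: real^1)"
  have F: "(\<lambda>x. F (g x)) absolutely_integrable_on S"
    using int by (simp add: absolutely_integrable_on_1_iff F_def)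
  have eq: "\<bar>det (matrix (g' x))\<bar> *\<^sub>R F (g x) = F (g x)" if "x \<in> S" for x
    using det[OF that] by simp
  have "(\<lambda>x. \<bar>det (matrix (g' x))\<bar> *\<^sub>R F (g x)) absolutely_integrable_on S"
    using F by (rule set_integrable_cong[THEN iffD1, rotated -1]) (auto simp: eq)
  moreover have "integral S (\<lambda>x. \<bar>det (matrix (g' x))\<bar> *\<^sub>R F (g x)) = integral S (\<lambda>x. F (g x))"
    by (rule integral_cong) (rule eq)
  ultimately have *: "F absolutely_integrable_on (g ` S)" "integral (g ` S) F = integral S (\<lambda>x. F (g x))"
    using has_absolute_integral_change_of_variables[OF S g inj, of F "integral S (\<lambda>x. F (g x))"] by auto
  have "set_integrable lebesgue (g ` S) f"
    using *(1) by (simp add: absolutely_integrable_on_1_iff F_def)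
  moreover have "integral (g ` S) f = integral S (\<lambda>x. f (g x))"
    using *(2) by (simp add: integral_on_1_eq F_def vec_eq_iff)
  ultimately show ?thesis
    using int by (simp add: set_lebesgue_integral_eq_integral)
qed

text \<open>
  By the mean value theorem, the bound on \<open>f'\<close> dominates the difference quotients in \<open>t\<close>.
\<close>

lemma has_real_derivative_set_integral:
  fixes f :: "'a::euclidean_space \<Rightarrow> real \<Rightarrow> real"
  assumes S: "S \<in> lmeasurable" and I: "open I" "convex I" "t0 \<in> I"
    and int: "\<And>t. t \<in> I \<Longrightarrow> set_integrable lebesgue S (\<lambda>a. f a t)"
    and der: "\<And>a t. a \<in> S \<Longrightarrow> t \<in> I \<Longrightarrow> (f a has_real_derivative f' a t) (at t)"
    and bound: "\<And>a t. a \<in> S \<Longrightarrow> t \<in> I \<Longrightarrow> \<bar>f' a t\<bar> \<le> B"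
  shows "((\<lambda>t. LINT a:S|lebesgue. f a t) has_real_derivative (LINT a:S|lebesgue. f' a t0)) (at t0)"
proof -
  let ?F = "\<lambda>t. LINT a:S|lebesgue. f a t"
  let ?q = "\<lambda>t a. (f a t - f a t0) / (t - t0)"
  have "((\<lambda>t. (?F t - ?F t0) / (t - t0)) \<longlongrightarrow> (LINT a:S|lebesgue. f' a t0)) (at t0 within I)"
    unfolding tendsto_at_iff_sequentially o_def
  proof (intro allI impI)
    fix X :: "nat \<Rightarrow> real" assume "\<forall>i. X i \<in> I - {t0}" and X: "X \<longlonglongrightarrow> t0"
    then have XI: "\<And>i. X i \<in> I" and Xn: "\<And>i. X i \<noteq> t0" by auto
    have q_int: "set_integrable lebesgue S (?q t)" if "t \<in> I" for t
      using set_integral_diff(1)[OF int[OF that] int[OF I(3)]] by (intro set_integrable_divide) auto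
    have q: "(?F t - ?F t0) / (t - t0) = (LINT a:S|lebesgue. ?q t a)" if "t \<in> I" for t
      using set_integral_diff(2)[OF int[OF that] int[OF I(3)]] by simp
    have lim: "(\<lambda>i. ?q (X i) a) \<longlonglongrightarrow> f' a t0" if "a \<in> S" for a
    proof -
      have "((\<lambda>t. ?q t a) \<longlongrightarrow> f' a t0) (at t0 within UNIV)"
        using der[OF that I(3)] by (simp add: has_field_derivative_iff)
      then show ?thesis
        unfolding tendsto_at_iff_sequentially o_def using X Xn by simp
    qed
    have qB: "\<bar>?q t a\<bar> \<le> B" if a: "a \<in> S" and t: "t \<in> I" "t \<noteq> t0" for a t
    proof -
      have "norm (f a t - f a t0) \<le> B * norm (t - t0)"
        by (rule field_differentiable_bound[OF I(2), of "f a" "f' a"])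
          (use der bound a t I in \<open>auto intro: has_field_derivative_at_within\<close>)
      then show ?thesis using t by (simp add: abs_divide field_simps)
    qed
    have "(\<lambda>i. LINT a:S|lebesgue. ?q (X i) a) \<longlonglongrightarrow> (LINT a:S|lebesgue. f' a t0)"
      unfolding set_lebesgue_integral_def
    proof (rule integral_dominated_convergence)
      show "(\<lambda>a. indicat_real S a *\<^sub>R ?q (X i) a) \<in> borel_measurable lebesgue" for i
        using q_int[OF XI] unfolding set_integrable_def by (rule borel_measurable_integrable)
      then show "(\<lambda>a. indicat_real S a *\<^sub>R f' a t0) \<in> borel_measurable lebesgue"
        by (rule borel_measurable_LIMSEQ_real[where u = "\<lambda>i a. indicat_real S a *\<^sub>R ?q (X i) a", rotated])
          (auto simp: indicator_def lim)
      show "integrable lebesgue (\<lambda>a. indicat_real S a *\<^sub>R B)"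
        using S by (auto simp: fmeasurable_def)
      show "AE a in lebesgue. (\<lambda>i. indicat_real S a *\<^sub>R ?q (X i) a) \<longlonglongrightarrow> indicat_real S a *\<^sub>R f' a t0"
        by (auto simp: indicator_def lim)
      show "AE a in lebesgue. norm (indicat_real S a *\<^sub>R ?q (X i) a) \<le> indicat_real S a *\<^sub>R B" for i
        using qB XI Xn by (auto simp: indicator_def)
    qed
    then show "(\<lambda>i. (?F (X i) - ?F t0) / (X i - t0)) \<longlonglongrightarrow> (LINT a:S|lebesgue. f' a t0)"
      by (subst q[OF XI]) simp
  qed
  then show ?thesis
    using at_within_open[OF I(3) I(1)] by (simp add: has_field_derivative_iff)
qed

section \<open>Symmetry of second derivatives\<close>

text \<open>
  The second difference of \<open>f\<close> over a small parallelogram spanned by \<open>h v\<close> and \<open>h w\<close> is, by the mean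
  value theorem used twice, \<open>h\<^sup>2\<close> times either mixed derivative at some point of the parallelogram,
  depending on the order in which the two directions are treated.
\<close>

lemma mixed_partials:
  fixes f :: "'a::real_normed_vector \<Rightarrow> real"
  assumes "open S" and z: "z \<in> S"
    and f: "\<And>x. x \<in> S \<Longrightarrow> (f has_derivative f' x) (at x)"
    and v: "\<And>x. x \<in> S \<Longrightarrow> ((\<lambda>x. f' x v) has_derivative fv x) (at x)"
    and w: "\<And>x. x \<in> S \<Longrightarrow> ((\<lambda>x. f' x w) has_derivative fw x) (at x)"
    and cv: "continuous (at z) (\<lambda>x. fv x w)" and cw: "continuous (at z) (\<lambda>x. fw x v)"
  shows "fv z w = fw z v"
proof -
  have *: "\<exists>x y. dist x z < e \<and> dist y z < e \<and> fv x w = fw y v" if e: "0 < e" for e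
  proof -
    obtain r where r: "0 < r" "ball z r \<subseteq> S"
      using \<open>open S\<close> z openE by blast
    define c where "c = norm v + norm w + 1"
    have c: "0 < c" "norm v + norm w \<le> c"
      by (simp_all add: c_def add_nonneg_pos)
    define h where "h = min e r / (2 * c)"
    have h: "0 < h" "h * (norm v + norm w) < min e r"
    proof -
      show "0 < h" using e r c by (simp add: h_def)
      then have "h * (norm v + norm w) \<le> h * c"
        using c by (intro mult_left_mono) auto
      also have "\<dots> = min e r / 2"
        using c by (simp add: h_def)
      also have "\<dots> < min e r" using e r by auto
      finally show "h * (norm v + norm w) < min e r" .
    qed
    have near: "dist (z + s *\<^sub>R v + t *\<^sub>R w) z < min e r" if "s \<in> {0..h}" "t \<in> {0..h}" for s t
    proof -
      have "dist (z + s *\<^sub>R v + t *\<^sub>R w) z \<le> s * norm v + t * norm w"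
        using norm_triangle_ineq[of "s *\<^sub>R v" "t *\<^sub>R w"] that by (simp add: dist_norm add.assoc)
      also have "\<dots> \<le> h * norm v + h * norm w"
        using that by (intro add_mono mult_right_mono) auto
      finally show ?thesis using h(2) by (simp add: algebra_simps)
    qed
    have inS: "z + s *\<^sub>R v + t *\<^sub>R w \<in> S" if "s \<in> {0..h}" "t \<in> {0..h}" for s t
      using near[OF that] r by (auto simp: dist_commute subset_iff)
    have along: "((\<lambda>t. g (p + t *\<^sub>R q)) has_derivative (\<lambda>h. h * g' (p + t *\<^sub>R q) q)) (at t within A)"
      if "(g has_derivative g' (p + t *\<^sub>R q)) (at (p + t *\<^sub>R q))" for g :: "'a \<Rightarrow> real" and g' p q t A
    proof -
      have "((\<lambda>t. p + t *\<^sub>R q) has_derivative (\<lambda>h. h *\<^sub>R q)) (at t within A)"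
        by (auto intro!: derivative_eq_intros)
      from has_derivative_compose[OF this that]
      show ?thesis
        using linear_scale[OF has_derivative_linear[OF that]] by (simp add: mult.commute)
    qed
    have mvt: "\<exists>\<xi>\<in>{0..h}. g h - g 0 = h * g' \<xi>"
      if "\<And>s. s \<in> {0..h} \<Longrightarrow> (g has_derivative (\<lambda>h. h * g' s)) (at s within {0..h})" for g g' :: "real \<Rightarrow> real"
      using mvt_very_simple[of 0 h g "\<lambda>s k. k * g' s"] h(1) that by auto
    have "\<exists>s\<in>{0..h}. \<exists>t\<in>{0..h}.
       f (z + h *\<^sub>R v + h *\<^sub>R w) - f (z + h *\<^sub>R v) - f (z + h *\<^sub>R w) + f z = h * (h * fv (z + s *\<^sub>R v + t *\<^sub>R w) w)"
    proof -
      let ?g = "\<lambda>s. f ((z + h *\<^sub>R w) + s *\<^sub>R v) - f (z + s *\<^sub>R v)"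
      have "\<exists>s\<in>{0..h}. ?g h - ?g 0 = h * (f' ((z + h *\<^sub>R w) + s *\<^sub>R v) v - f' (z + s *\<^sub>R v) v)"
      proof (rule mvt)
        fix s assume s: "s \<in> {0..h}"
        have "(z + h *\<^sub>R w) + s *\<^sub>R v \<in> S" "z + s *\<^sub>R v \<in> S"
          using inS[of s h] inS[of s 0] s h(1) by (auto simp: add_ac)
        from has_derivative_diff[OF along[where g = f and g' = f', OF f[OF this(1)]] along[where g = f and g' = f', OF f[OF this(2)]]]
        show "(?g has_derivative (\<lambda>k. k * (f' ((z + h *\<^sub>R w) + s *\<^sub>R v) v - f' (z + s *\<^sub>R v) v))) (at s within {0..h})"
          by (simp add: right_diff_distrib)
      qed
      then obtain s where s: "s \<in> {0..h}" "?g h - ?g 0 = h * (f' ((z + h *\<^sub>R w) + s *\<^sub>R v) v - f' (z + s *\<^sub>R v) v)" by blast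
      let ?k = "\<lambda>t. f' ((z + s *\<^sub>R v) + t *\<^sub>R w) v"
      have "\<exists>t\<in>{0..h}. ?k h - ?k 0 = h * fv ((z + s *\<^sub>R v) + t *\<^sub>R w) w"
      proof (rule mvt)
        fix t assume "t \<in> {0..h}"
        then show "(?k has_derivative (\<lambda>k. k * fv ((z + s *\<^sub>R v) + t *\<^sub>R w) w)) (at t within {0..h})"
          by (intro along[where g = "\<lambda>x. f' x v" and g' = fv] v inS s)
      qed
      then show ?thesis using s by (force simp: add_ac)
    qed
    moreover have "\<exists>s\<in>{0..h}. \<exists>t\<in>{0..h}.
       f (z + h *\<^sub>R v + h *\<^sub>R w) - f (z + h *\<^sub>R v) - f (z + h *\<^sub>R w) + f z = h * (h * fw (z + s *\<^sub>R v + t *\<^sub>R w) v)"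
    proof -
      let ?g = "\<lambda>t. f ((z + h *\<^sub>R v) + t *\<^sub>R w) - f (z + t *\<^sub>R w)"
      have "\<exists>t\<in>{0..h}. ?g h - ?g 0 = h * (f' ((z + h *\<^sub>R v) + t *\<^sub>R w) w - f' (z + t *\<^sub>R w) w)"
      proof (rule mvt)
        fix s assume s: "s \<in> {0..h}"
        have "(z + h *\<^sub>R v) + s *\<^sub>R w \<in> S" "z + s *\<^sub>R w \<in> S"
          using inS[of h s] inS[of 0 s] s h(1) by (auto simp: add_ac)
        from has_derivative_diff[OF along[where g = f and g' = f', OF f[OF this(1)]] along[where g = f and g' = f', OF f[OF this(2)]]]
        show "(?g has_derivative (\<lambda>k. k * (f' ((z + h *\<^sub>R v) + s *\<^sub>R w) w - f' (z + s *\<^sub>R w) w))) (at s within {0..h})"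
          by (simp add: right_diff_distrib)
      qed
      then obtain t where t: "t \<in> {0..h}" "?g h - ?g 0 = h * (f' ((z + h *\<^sub>R v) + t *\<^sub>R w) w - f' (z + t *\<^sub>R w) w)" by blast
      let ?k = "\<lambda>s. f' ((z + t *\<^sub>R w) + s *\<^sub>R v) w"
      have "\<exists>s\<in>{0..h}. ?k h - ?k 0 = h * fw ((z + t *\<^sub>R w) + s *\<^sub>R v) v"
      proof (rule mvt)
        fix s assume "s \<in> {0..h}"
        then have "(z + t *\<^sub>R w) + s *\<^sub>R v \<in> S" using inS[of s t] t by (simp add: add_ac)
        then show "(?k has_derivative (\<lambda>k. k * fw ((z + t *\<^sub>R w) + s *\<^sub>R v) v)) (at s within {0..h})"
          by (intro along[where g = "\<lambda>x. f' x w" and g' = fw] w)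
      qed
      then show ?thesis using t by (force simp: add_ac)
    qed
    ultimately show ?thesis
      using near h(1) by (metis (no_types, lifting) min_less_iff_conj mult_cancel_left order_less_irrefl)
  qed
  show ?thesis
  proof (rule ccontr)
    assume "fv z w \<noteq> fw z v"
    then have "0 < dist (fv z w) (fw z v) / 2" by simp
    then obtain d1 d2 where d: "0 < d1" "0 < d2"
      "\<And>x. dist x z < d1 \<Longrightarrow> dist (fv x w) (fv z w) < dist (fv z w) (fw z v) / 2"
      "\<And>x. dist x z < d2 \<Longrightarrow> dist (fw x v) (fw z v) < dist (fv z w) (fw z v) / 2"
      using cv cw unfolding continuous_at_eps_delta by metis
    obtain x y where xy: "dist x z < min d1 d2" "dist y z < min d1 d2" "fv x w = fw y v"
      using *[of "min d1 d2"] d by auto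
    show False
      using d(3)[of x] d(4)[of y] xy dist_triangle_half_r[of "fv x w" "fv z w" "dist (fv z w) (fw z v)" "fw z v"]
      by (simp add: dist_commute)
  qed
qed

section \<open>Smooth space-time fields\<close>

abbreviation spacetime :: "((real^3) \<times> real) set" where
  "spacetime \<equiv> UNIV \<times> {0..}"

lemma interior_spacetime: "0 < t \<Longrightarrow> (x, t) \<in> interior spacetime"
  by (simp add: interior_Times)

lemma smooth_fieldE:
  assumes "smooth_field f"
  obtains f' f'' where
    "\<And>z. z \<in> spacetime \<Longrightarrow> ((\<lambda>(x, t). f x t) has_derivative f' z) (at z within spacetime)"
    "\<And>v z. z \<in> spacetime \<Longrightarrow> ((\<lambda>z. f' z v) has_derivative f'' v z) (at z within spacetime)"
    "\<And>v w. continuous_on spacetime (\<lambda>z. f'' v z w)"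
proof -
  obtain f' where 1: "\<And>z. z \<in> spacetime \<Longrightarrow> ((\<lambda>(x, t). f x t) has_derivative f' z) (at z within spacetime)"
    and 2: "\<And>v. Ck_on 1 (\<lambda>z. f' z v) spacetime"
    using assms by (auto simp: smooth_field_def numeral_2_eq_2)
  have "\<exists>g. (\<forall>z\<in>spacetime. ((\<lambda>z. f' z v) has_derivative g z) (at z within spacetime)) \<and>
      (\<forall>w. continuous_on spacetime (\<lambda>z. g z w))" for v
    using 2[of v] by simp
  then show thesis using that[of f'] 1 by metis
qed

lemma spatial_derivative:
  fixes f :: "real^3 \<Rightarrow> real \<Rightarrow> 'b::real_normed_vector"
  assumes "((\<lambda>(x, t). f x t) has_derivative g) (at (x, t) within spacetime)" "0 \<le> t"
  shows "((\<lambda>y. f y t) has_derivative (\<lambda>v. g (v, 0))) (at x)"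
proof -
  have "((\<lambda>y. (y, t)) has_derivative (\<lambda>v. (v, 0))) (at x)"
    by (auto intro!: derivative_eq_intros)
  moreover have "((\<lambda>(x, t). f x t) has_derivative g) (at (x, t) within range (\<lambda>y. (y, t)))"
    by (rule has_derivative_subset[OF assms(1)]) (use assms(2) in auto)
  ultimately show ?thesis
    using has_derivative_in_compose[of "\<lambda>y. (y, t)" "\<lambda>v. (v, 0)" x UNIV "\<lambda>(x, t). f x t" g] by simp
qed

lemma partial_eqI:
  assumes "(f has_derivative g) (at x)"
  shows "partial j f x = g (axis j 1)"
proof -
  have "((\<lambda>h::real. x + h *\<^sub>R axis j 1) has_derivative (\<lambda>h. h *\<^sub>R axis j 1)) (at 0)"
    by (auto intro!: derivative_eq_intros)
  moreover have "(f has_derivative g) (at (x + 0 *\<^sub>R axis j 1))" using assms by simp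
  ultimately have "((\<lambda>h. f (x + h *\<^sub>R axis j 1)) has_derivative (\<lambda>h. g (h *\<^sub>R axis j 1))) (at 0)"
    by (rule has_derivative_compose)
  moreover have "(\<lambda>h. g (h *\<^sub>R axis j 1)) = (\<lambda>h. h *\<^sub>R g (axis j 1))"
    using linear_scale[OF has_derivative_linear[OF assms]] by auto
  ultimately have "((\<lambda>h. f (x + h *\<^sub>R axis j 1)) has_vector_derivative g (axis j 1)) (at 0)"
    by (simp add: has_vector_derivative_def)
  then show ?thesis
    unfolding partial_def by (rule vector_derivative_at)
qed

lemma time_deriv_eqI:
  fixes f :: "real^3 \<Rightarrow> real \<Rightarrow> 'b::real_normed_vector"
  assumes g: "((\<lambda>(x, t). f x t) has_derivative g) (at (x, t) within spacetime)" and t: "0 < t"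
  shows "time_deriv f x t = g (0, 1)"
proof -
  have "((\<lambda>s. (x, s)) has_derivative (\<lambda>s. (0, s))) (at t)"
    by (auto intro!: derivative_eq_intros)
  moreover have "((\<lambda>(x, t). f x t) has_derivative g) (at (x, t))"
    using g by (simp add: at_within_interior[OF interior_spacetime[OF t]])
  ultimately have "((\<lambda>s. f x s) has_derivative (\<lambda>s. g (0, s))) (at t)"
    using has_derivative_compose[of "\<lambda>s. (x, s)" "\<lambda>s. (0, s)" t UNIV "\<lambda>(x, t). f x t" g] by simp
  moreover have "(\<lambda>s. g (0, s)) = (\<lambda>s. s *\<^sub>R g (0, 1))"
  proof
    fix s
    show "g (0, s) = s *\<^sub>R g (0, 1)"
      using linear_scale[OF has_derivative_linear[OF g], of s "(0, 1)"] by simp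
  qed
  ultimately have "((\<lambda>s. f x s) has_vector_derivative g (0, 1)) (at t)"
    by (simp add: has_vector_derivative_def)
  moreover have "at t within {0..} = at t"
    using t by (intro at_within_interior) (simp add: interior_real_atLeast)
  ultimately show ?thesis
    unfolding time_deriv_def by (simp add: vector_derivative_at)
qed

lemma mixed_partials_euclidean:
  fixes f :: "'a::real_normed_vector \<Rightarrow> 'b::euclidean_space"
  assumes S: "open S" "z \<in> S"
    and f: "\<And>x. x \<in> S \<Longrightarrow> (f has_derivative f' x) (at x)"
    and f': "\<And>v x. x \<in> S \<Longrightarrow> ((\<lambda>x. f' x v) has_derivative f'' v x) (at x)"
    and cont: "\<And>v w. continuous (at z) (\<lambda>x. f'' v x w)"
  shows "f'' v z w = f'' w z v"
proof (rule euclidean_eqI)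
  fix b :: 'b assume "b \<in> Basis"
  show "f'' v z w \<bullet> b = f'' w z v \<bullet> b"
    by (rule mixed_partials[OF S, where f = "\<lambda>x. f x \<bullet> b" and f' = "\<lambda>x v. f' x v \<bullet> b"])
      (auto intro!: has_derivative_inner_left f f' cont continuous_intros)
qed

definition velocity_gradient :: "vector_field \<Rightarrow> real^3 \<Rightarrow> real \<Rightarrow> real^3^3" where
  "velocity_gradient u x t = (\<chi> i j. partial j (\<lambda>y. u y t $ i) x)"

lemma curl_velocity_gradient:
  "curl u x t = (let J = velocity_gradient u x t in
    vector [J $ 3 $ 2 - J $ 2 $ 3, J $ 1 $ 3 - J $ 3 $ 1, J $ 2 $ 1 - J $ 1 $ 2])"
  by (simp add: curl_def velocity_gradient_def)

lemma trace_velocity_gradient: "trace (velocity_gradient u x t) = divergence u x t"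
  by (simp add: trace_def divergence_def velocity_gradient_def)

text \<open>
  The antisymmetric part of \<open>\<nabla>u\<close> acts as \<open>w \<mapsto> (\<omega> \<times> w) / 2\<close>, so it annihilates the vorticity \<open>\<omega>\<close>.
\<close>

lemma strain_mult_curl: "strain u x t *v curl u x t = velocity_gradient u x t *v curl u x t"
  by (simp add: vec_eq_iff forall_3 matrix_vector_mult_def sum_3 strain_def curl_velocity_gradient
      velocity_gradient_def Let_def field_simps)

lemma transpose_strain: "transpose (strain u x t) = strain u x t"
  by (simp add: strain_def transpose_def vec_eq_iff add.commute)

lemma axis_expansion: "v = (\<Sum>k\<in>UNIV. v $ k *\<^sub>R axis k (1::real))"
  by (simp add: vec_eq_iff axis_def if_distrib cong: if_cong)

lemma smooth_velocity_jacobian: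
  assumes "smooth_field u"
  shows "0 \<le> t \<Longrightarrow> ((\<lambda>y. u y t) has_derivative (*v) (velocity_gradient u x t)) (at x)"
    and "continuous_on spacetime (\<lambda>(x, t). velocity_gradient u x t)"
proof -
  obtain u' u'' where
    u': "\<And>z. z \<in> spacetime \<Longrightarrow> ((\<lambda>(x, t). u x t) has_derivative u' z) (at z within spacetime)" and
    u'': "\<And>v z. z \<in> spacetime \<Longrightarrow> ((\<lambda>z. u' z v) has_derivative u'' v z) (at z within spacetime)"
    using smooth_fieldE[OF assms] by metis
  have sp: "((\<lambda>y. u y t) has_derivative (\<lambda>v. u' (x, t) (v, 0))) (at x)" if "0 \<le> t" for x t
    using that by (intro spatial_derivative u') auto
  have J: "velocity_gradient u x t $ i $ j = u' (x, t) (axis j 1, 0) $ i" if "0 \<le> t" for x t i j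
    unfolding velocity_gradient_def
    by (simp add: partial_eqI[OF bounded_linear.has_derivative[OF bounded_linear_vec_nth sp[OF that]]])
  show "((\<lambda>y. u y t) has_derivative (*v) (velocity_gradient u x t)) (at x)" if t: "0 \<le> t" for x t
  proof -
    have lin: "linear (\<lambda>v. u' (x, t) (v, 0))" using has_derivative_linear[OF sp[OF t]] .
    have "(\<lambda>v. u' (x, t) (v, 0)) = (*v) (velocity_gradient u x t)"
    proof
      fix v
      show "u' (x, t) (v, 0) = velocity_gradient u x t *v v"
        by (subst axis_expansion[of v])
          (simp add: vec_eq_iff linear_sum[OF lin] linear_scale[OF lin] J[OF t] matrix_vector_mult_def mult.commute)
    qed
    then show ?thesis using sp[OF t, of x] by simp
  qed
  have "continuous_on spacetime (\<lambda>z. u' z (axis j 1, 0))" for j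
    using has_derivative_continuous_on u'' by blast
  then have "continuous_on spacetime (\<lambda>z. \<chi> i j. u' z (axis j 1, 0) $ i)"
    by (intro continuous_intros)
  then show "continuous_on spacetime (\<lambda>(x, t). velocity_gradient u x t)"
    by (rule continuous_on_cong[THEN iffD1, rotated -1]) (auto simp: vec_eq_iff J)
qed


text \<open>
  In the interior of the half space the derivatives within the half space are derivatives in the
  usual sense, and the second one is symmetric. The momentum equation is used there only, that is,
  at positive times.
\<close>

lemma smooth_field_interiorE:
  fixes f :: "real^3 \<Rightarrow> real \<Rightarrow> 'b::euclidean_space"
  assumes "smooth_field f"
  obtains f' f'' where
    "\<And>z. z \<in> interior spacetime \<Longrightarrow> ((\<lambda>(x, t). f x t) has_derivative f' z) (at z)"
    "\<And>v z. z \<in> interior spacetime \<Longrightarrow> ((\<lambda>z. f' z v) has_derivative f'' v z) (at z)"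
    "\<And>v w z. z \<in> interior spacetime \<Longrightarrow> f'' v z w = f'' w z v"
proof -
  obtain f' f'' where
    f': "\<And>z. z \<in> spacetime \<Longrightarrow> ((\<lambda>(x, t). f x t) has_derivative f' z) (at z within spacetime)" and
    f'': "\<And>v z. z \<in> spacetime \<Longrightarrow> ((\<lambda>z. f' z v) has_derivative f'' v z) (at z within spacetime)" and
    cont: "\<And>v w. continuous_on spacetime (\<lambda>z. f'' v z w)"
    using smooth_fieldE[OF assms] by metis
  have at: "z \<in> spacetime" "at z within spacetime = at z" if "z \<in> interior spacetime" for z
    using that interior_subset at_within_interior by blast+
  have 1: "((\<lambda>(x, t). f x t) has_derivative f' z) (at z)" if "z \<in> interior spacetime" for z
    using f'[OF at(1)[OF that]] by (simp add: at(2)[OF that])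
  have 2: "((\<lambda>z. f' z v) has_derivative f'' v z) (at z)" if "z \<in> interior spacetime" for z v
    using f''[OF at(1)[OF that]] by (simp add: at(2)[OF that])
  have "f'' v z w = f'' w z v" if "z \<in> interior spacetime" for v w z
    using that 1 2 continuous_on_interior[OF cont]
    by (intro mixed_partials_euclidean[of "interior spacetime" z "\<lambda>(x, t). f x t" f' f'']) auto
  with 1 2 show thesis by (rule that)
qed

lemma second_partial_eqI:
  fixes f :: "real^3 \<Rightarrow> real \<Rightarrow> 'b::real_normed_vector"
  assumes f': "\<And>z. z \<in> interior spacetime \<Longrightarrow> ((\<lambda>(x, t). f x t) has_derivative f' z) (at z)"
    and f'': "((\<lambda>z. f' z (axis j 1, 0)) has_derivative f'') (at (x, t))" and t: "0 < t"
  shows "partial i (partial j (\<lambda>y. f y t)) x = f'' (axis i 1, 0)"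
proof -
  have "partial j (\<lambda>y. f y t) = (\<lambda>x. f' (x, t) (axis j 1, 0))"
    using spatial_derivative[OF has_derivative_at_withinI[OF f'[OF interior_spacetime[OF t]]]] t
    by (auto intro!: ext partial_eqI)
  moreover have "((\<lambda>x. f' (x, t) (axis j 1, 0)) has_derivative (\<lambda>v. f'' (v, 0))) (at x)"
    using spatial_derivative[of "\<lambda>x t. f' (x, t) (axis j 1, 0)" f'' x t] has_derivative_at_withinI[OF f''] t
    by (simp add: split_def)
  ultimately show ?thesis
    by (simp add: partial_eqI)
qed

lemma pressure_hessian_symmetric:
  assumes p: "smooth_field p" and t: "0 < t"
  shows "pressure_hessian p x t $ i $ j = pressure_hessian p x t $ j $ i"
proof -
  obtain p' p'' where p': "\<And>z. z \<in> interior spacetime \<Longrightarrow> ((\<lambda>(x, t). p x t) has_derivative p' z) (at z)"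
    and p'': "\<And>v z. z \<in> interior spacetime \<Longrightarrow> ((\<lambda>z. p' z v) has_derivative p'' v z) (at z)"
    and sym: "\<And>v w z. z \<in> interior spacetime \<Longrightarrow> p'' v z w = p'' w z v"
    by (rule smooth_field_interiorE[OF p]) blast
  note z = interior_spacetime[OF t]
  show ?thesis
    unfolding pressure_hessian_def
    by (simp add: second_partial_eqI[OF p' p''[OF z] t] sym[OF z, of "(axis i 1, 0)"])
qed

text \<open>
  Differentiating the momentum equation in space gives \<open>D A / Dt = - P - A A\<close> for \<open>A = \<nabla>u\<close>: the
  term \<open>A A\<close> comes from the derivative falling on the transporting velocity. The
  equation is of first order, so its derivative involves second derivatives of \<open>u\<close> and \<open>p\<close>, and
  their symmetry lets the space derivative pass \<open>\<partial>/\<partial>t\<close> and \<open>\<partial>/\<partial>x\<^sub>k\<close>.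
\<close>

lemma velocity_gradient_along_trajectory:
  assumes u: "smooth_field u" and p: "smooth_field p" and euler: "euler_solution u p"
    and t: "0 < t" and X: "(X has_vector_derivative u (X t) t) (at t)"
  shows "((\<lambda>s. velocity_gradient u (X s) s $ i $ j) has_real_derivative
    - pressure_hessian p (X t) t $ i $ j -
    (velocity_gradient u (X t) t ** velocity_gradient u (X t) t) $ i $ j) (at t)"
proof -
  let ?S = "interior spacetime"
  obtain u' u'' where
    u': "\<And>z. z \<in> ?S \<Longrightarrow> ((\<lambda>(x, t). u x t) has_derivative u' z) (at z)" and
    u'': "\<And>v z. z \<in> ?S \<Longrightarrow> ((\<lambda>z. u' z v) has_derivative u'' v z) (at z)" and
    u_sym: "\<And>v w z. z \<in> ?S \<Longrightarrow> u'' v z w = u'' w z v"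
    by (rule smooth_field_interiorE[OF u]) blast
  obtain p' p'' where
    p': "\<And>z. z \<in> ?S \<Longrightarrow> ((\<lambda>(x, t). p x t) has_derivative p' z) (at z)" and
    p'': "\<And>v z. z \<in> ?S \<Longrightarrow> ((\<lambda>z. p' z v) has_derivative p'' v z) (at z)" and
    p_sym: "\<And>v w z. z \<in> ?S \<Longrightarrow> p'' v z w = p'' w z v"
    by (rule smooth_field_interiorE[OF p]) blast
  have within: "((\<lambda>(x, t). u x t) has_derivative u' (x, s)) (at (x, s) within spacetime)"
    "((\<lambda>(x, t). p x t) has_derivative p' (x, s)) (at (x, s) within spacetime)" if "0 < s" for x s
    using u' p' interior_spacetime[OF that] by (auto intro: has_derivative_at_withinI)
  define z where "z = (X t, t)"
  have z: "z \<in> ?S" using t by (simp add: z_def interior_spacetime)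
  define E where "E = (\<lambda>j. (axis j 1, 0) :: (real^3) \<times> real)"
  define \<tau> where "\<tau> = ((0, 1) :: (real^3) \<times> real)"
  have J: "velocity_gradient u x s $ i $ j = u' (x, s) (E j) $ i" if "0 < s" for x s i j
    unfolding velocity_gradient_def E_def using that
    by (simp add: partial_eqI[OF bounded_linear.has_derivative[OF bounded_linear_vec_nth
          spatial_derivative[OF within(1)]]])
  have dp: "partial j (\<lambda>y. p y s) x = p' (x, s) (E j)" if "0 < s" for x s j
    unfolding E_def using that by (simp add: partial_eqI[OF spatial_derivative[OF within(2)]])
  have P: "pressure_hessian p (X t) t $ i $ j = p'' (E i) z (E j)" for i j
    using second_partial_eqI[OF p' p''[OF z, unfolded z_def] t] p_sym[OF z, of "E i" "E j"]
    by (simp add: pressure_hessian_def E_def z_def)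
  have momentum: "u' y \<tau> $ i + (\<Sum>k\<in>UNIV. (case y of (x, s) \<Rightarrow> u x s) $ k * u' y (E k) $ i) + p' y (E i) = 0"
    if y: "y \<in> ?S" for y i
  proof -
    obtain x s where ys: "y = (x, s)" by fastforce
    have s: "0 < s" using y by (auto simp: ys interior_Times)
    have td: "time_deriv u x s = u' y \<tau>"
      using time_deriv_eqI[of u "u' y" x s] within(1)[of s x] s by (simp add: ys \<tau>_def)
    have du: "partial k (\<lambda>y. u y s) x = u' y (E k)" for k
      using partial_eqI[OF spatial_derivative[of u "u' y" x s]] within(1)[of s x] s by (simp add: ys E_def)
    have "material_deriv u u x s = - gradient p x s"
      using euler s by (simp add: euler_solution_def)
    then have "material_deriv u u x s $ i = - gradient p x s $ i" by simp
    then show ?thesis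
      using s by (simp add: material_deriv_def td du gradient_def dp ys sum_component)
  qed
  \<comment> \<open>The left side of \<open>momentum\<close> vanishes identically near \<open>z\<close>, so its derivative at \<open>z\<close> does.\<close>
  have momentum': "u'' \<tau> z v $ i + (\<Sum>k\<in>UNIV. u (X t) t $ k * u'' (E k) z v $ i + u' z v $ k * u' z (E k) $ i)
      + p'' (E i) z v = 0" for v i
  proof -
    let ?h = "\<lambda>y. u' y \<tau> $ i + (\<Sum>k\<in>UNIV. (case y of (x, s) \<Rightarrow> u x s) $ k * u' y (E k) $ i) + p' y (E i)"
    let ?h' = "\<lambda>v. u'' \<tau> z v $ i + (\<Sum>k\<in>UNIV. (case z of (x, s) \<Rightarrow> u x s) $ k * u'' (E k) z v $ i + u' z v $ k * u' z (E k) $ i)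
      + p'' (E i) z v"
    have "(?h has_derivative ?h') (at z)"
      by (intro has_derivative_add has_derivative_sum has_derivative_mult p''[OF z]
          bounded_linear.has_derivative[OF bounded_linear_vec_nth] u''[OF z] u'[OF z])
    moreover have "(?h has_derivative (\<lambda>v. 0)) (at z)"
      by (rule has_derivative_transform_within_open[OF has_derivative_const[where c = 0] open_interior z])
        (simp add: momentum)
    ultimately have "?h' = (\<lambda>v. 0)" by (rule has_derivative_unique)
    then have "?h' v = 0" by (rule fun_cong)
    then show ?thesis by (simp add: z_def)
  qed
  have "((\<lambda>s. (X s, s)) has_derivative (\<lambda>h. (h *\<^sub>R u (X t) t, h))) (at t)"
    using X by (auto intro!: derivative_eq_intros simp: has_vector_derivative_def)
  from has_derivative_compose[OF this u''[OF z, unfolded z_def, of "E j"]]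
  have "((\<lambda>s. u' (X s, s) (E j)) has_derivative (\<lambda>h. u'' (E j) z (h *\<^sub>R u (X t) t, h))) (at t)"
    by (simp add: z_def)
  from bounded_linear.has_derivative[OF bounded_linear_vec_nth this]
  have "((\<lambda>s. u' (X s, s) (E j) $ i) has_derivative (\<lambda>h. u'' (E j) z (h *\<^sub>R u (X t) t, h) $ i)) (at t)" .
  moreover have "u'' (E j) z (h *\<^sub>R u (X t) t, h) $ i = (- pressure_hessian p (X t) t $ i $ j -
    (velocity_gradient u (X t) t ** velocity_gradient u (X t) t) $ i $ j) * h" for h
  proof -
    have lin: "linear (u'' (E j) z)" using has_derivative_linear[OF u''[OF z]] .
    have "(h *\<^sub>R u (X t) t, h) = h *\<^sub>R ((\<Sum>k\<in>UNIV. u (X t) t $ k *\<^sub>R E k) + \<tau>)"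
      by (subst axis_expansion[of "u (X t) t"])
        (simp add: E_def \<tau>_def prod_eq_iff fst_sum snd_sum)
    then have "u'' (E j) z (h *\<^sub>R u (X t) t, h) $ i =
        h * ((\<Sum>k\<in>UNIV. u (X t) t $ k * u'' (E j) z (E k) $ i) + u'' (E j) z \<tau> $ i)"
      by (simp add: linear_scale[OF lin] linear_add[OF lin] linear_sum[OF lin])
    also have "\<dots> = h * ((\<Sum>k\<in>UNIV. u (X t) t $ k * u'' (E k) z (E j) $ i) + u'' \<tau> z (E j) $ i)"
      by (simp add: u_sym[OF z, of "E j"])
    also have "(\<Sum>k\<in>UNIV. u (X t) t $ k * u'' (E k) z (E j) $ i) + u'' \<tau> z (E j) $ i
        = - p'' (E i) z (E j) - (\<Sum>k\<in>UNIV. u' z (E k) $ i * u' z (E j) $ k)"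
      using momentum'[where v = "E j" and i = i] by (simp add: sum.distrib mult.commute)
    also have "\<dots> = - pressure_hessian p (X t) t $ i $ j -
        (velocity_gradient u (X t) t ** velocity_gradient u (X t) t) $ i $ j"
      using t by (simp add: P matrix_matrix_mult_def J z_def)
    finally show ?thesis by (simp add: mult.commute)
  qed
  ultimately have "((\<lambda>s. u' (X s, s) (E j) $ i) has_real_derivative - pressure_hessian p (X t) t $ i $ j -
    (velocity_gradient u (X t) t ** velocity_gradient u (X t) t) $ i $ j) (at t)"
    by (simp add: has_field_derivative_def fun_eq_iff[symmetric])
  then show ?thesis
    by (rule has_field_derivative_transform_within_open[where S = "{0<..}"]) (use t J in auto)
qed



section \<open>Vorticity and strain along a trajectory\<close>

lemma has_vector_derivative_vecI:
  fixes f :: "real \<Rightarrow> real^'n"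
  assumes "\<And>i. ((\<lambda>t. f t $ i) has_real_derivative f' $ i) (at t within S)"
  shows "(f has_vector_derivative f') (at t within S)"
  unfolding has_vector_derivative_def
  by (subst has_derivative_componentwise_within)
    (use assms in \<open>auto simp: Basis_vec_def inner_axis has_field_derivative_def mult.commute[of _ "_ $ _"]\<close>)

text \<open>
  With \<open>A = \<nabla>u\<close>, the vorticity consists of the entries of \<open>A - transpose A\<close>. In
  \<open>D A / Dt = - P - A A\<close> the symmetric matrix \<open>P\<close> drops out of it, and \<open>- A A\<close> contributes \<open>A \<omega> - (tr A) \<omega> = A \<omega>\<close>. Since
  \<open>S \<omega> = A \<omega>\<close>, differentiating once more gives \<open>(- P - A A) \<omega> + A (A \<omega>) = - P \<omega>\<close>.
  Thus two derivatives of \<open>\<omega>\<close> along a trajectory exist although \<open>u\<close> is only of class $C^2$.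
\<close>

lemma vorticity_along_trajectory:
  assumes u: "smooth_field u" and p: "smooth_field p" and euler: "euler_solution u p"
    and t: "0 < t" and X: "(X has_vector_derivative u (X t) t) (at t)"
  shows "((\<lambda>s. curl u (X s) s) has_vector_derivative strain u (X t) t *v curl u (X t) t) (at t)"
    and "((\<lambda>s. strain u (X s) s *v curl u (X s) s) has_vector_derivative
      - (pressure_hessian p (X t) t *v curl u (X t) t)) (at t)"
proof -
  let ?J = "\<lambda>s. velocity_gradient u (X s) s" and ?\<omega> = "\<lambda>s. curl u (X s) s" and ?P = "pressure_hessian p (X t) t"
  note dJ = velocity_gradient_along_trajectory[OF u p euler t X]
  note P = pressure_hessian_symmetric[OF p t, of "X t"]
  have "divergence u (X t) t = 0"
    using euler t by (simp add: euler_solution_def)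
  then have tr: "?J t $ 3 $ 3 = - ?J t $ 1 $ 1 - ?J t $ 2 $ 2"
    by (simp add: trace_velocity_gradient[symmetric] trace_def sum_3)
  have d\<omega>: "((\<lambda>s. ?\<omega> s $ i) has_real_derivative (?J t *v ?\<omega> t) $ i) (at t)" for i
  proof -
    have "\<forall>i. ((\<lambda>s. ?\<omega> s $ i) has_real_derivative (?J t *v ?\<omega> t) $ i) (at t)"
      unfolding forall_3 curl_velocity_gradient Let_def
      by (auto intro!: derivative_eq_intros dJ
          simp: matrix_matrix_mult_def matrix_vector_mult_def sum_3 tr P[of 2 1] P[of 3 1] P[of 3 2] algebra_simps)
    then show ?thesis ..
  qed
  then show "(?\<omega> has_vector_derivative strain u (X t) t *v ?\<omega> t) (at t)"
    unfolding strain_mult_curl by (rule has_vector_derivative_vecI)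
  have "((\<lambda>s. (?J s *v ?\<omega> s) $ i) has_real_derivative (- (?P *v ?\<omega> t)) $ i) (at t)" for i
    unfolding matrix_vector_mult_def sum_3
    by (auto intro!: derivative_eq_intros dJ d\<omega>
        simp: matrix_matrix_mult_def matrix_vector_mult_def sum_3 algebra_simps)
  then show "((\<lambda>s. strain u (X s) s *v ?\<omega> s) has_vector_derivative - (?P *v ?\<omega> t)) (at t)"
    unfolding strain_mult_curl by (rule has_vector_derivative_vecI)
qed

section \<open>Symmetric matrices are bounded by their largest eigenvalue\<close>

lemma symmetric_matrix_inner:
  fixes S :: "real^'n^'n"
  assumes "transpose S = S"
  shows "(S *v x) \<bullet> y = x \<bullet> (S *v y)"
  by (metis assms dot_lmul_matrix transpose_matrix_vector)

text \<open>
  If \<open>k\<close> is the maximum of \<open>\<bar>S x\<bar>\<close> on the unit sphere, attained at \<open>v\<close>, the quadratic form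
  \<open>k\<^sup>2 \<bar>x\<bar>\<^sup>2 - \<bar>S x\<bar>\<^sup>2\<close> is nonnegative and vanishes at \<open>v\<close>; hence so does its gradient, which says
  \<open>S (S v) = k\<^sup>2 v\<close>. As \<open>(S - k) (S + k) v = 0\<close>, either \<open>S v = - k v\<close>, or \<open>S v + k v\<close> is an eigenvector
  for \<open>k\<close>.
\<close>

lemma symmetric_eigenvalue_max:
  fixes S :: "real^'n^'n"
  assumes sym: "transpose S = S"
  obtains m where "m \<in> eigenvalues S" "\<And>x. norm (S *v x) \<le> \<bar>m\<bar> * norm x"
proof -
  have "continuous_on (sphere (0 :: real^'n) 1) (\<lambda>x. norm (S *v x))"
    by (intro continuous_intros linear_continuous_on matrix_vector_mul_bounded_linear)
  moreover have "sphere (0 :: real^'n) 1 \<noteq> {}" by (auto simp: sphere_eq_empty)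
  ultimately obtain v where v: "norm v = 1" and max: "\<And>x. norm x = 1 \<Longrightarrow> norm (S *v x) \<le> norm (S *v v)"
    using continuous_attains_sup[OF compact_sphere, of 0 1 "\<lambda>x. norm (S *v x)"] by force
  define k where "k = norm (S *v v)"
  have k: "norm (S *v x) \<le> k * norm x" for x
  proof (cases "x = 0")
    case False
    have "norm (S *v ((1 / norm x) *\<^sub>R x)) \<le> k"
      unfolding k_def by (rule max) (use False in simp)
    then show ?thesis using False by (simp add: matrix_vector_mult_scaleR field_simps)
  qed simp
  define q where "q = (\<lambda>x. k\<^sup>2 * (x \<bullet> x) - (S *v x) \<bullet> (S *v x))"
  have q: "0 \<le> q x" for x
    using power_mono[OF k[of x], of 2] by (simp add: q_def power_mult_distrib power2_norm_eq_inner)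
  define b where "b = k\<^sup>2 *\<^sub>R v - S *v (S *v v)"
  have qb: "q (v + t *\<^sub>R b) = 2 * t * (b \<bullet> b) + t\<^sup>2 * q b" for t
  proof -
    have expand: "(x + t *\<^sub>R y) \<bullet> (x + t *\<^sub>R y) = x \<bullet> x + 2 * t * (x \<bullet> y) + t\<^sup>2 * (y \<bullet> y)"
      for x y :: "real^'n"
      by (simp add: inner_add_left inner_add_right inner_commute[of y x] power2_eq_square algebra_simps)
    have "v \<bullet> v = 1"
      using v by (simp add: dot_square_norm)
    then have "q v = 0"
      by (simp add: q_def k_def power2_norm_eq_inner)
    moreover have "b \<bullet> b = k\<^sup>2 * (v \<bullet> b) - (S *v v) \<bullet> (S *v b)"
      by (subst (1) b_def) (simp add: inner_diff_left symmetric_matrix_inner[OF sym])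
    moreover have "q (v + t *\<^sub>R b) = q v + 2 * t * (k\<^sup>2 * (v \<bullet> b) - (S *v v) \<bullet> (S *v b)) + t\<^sup>2 * q b"
      unfolding q_def matrix_vector_right_distrib matrix_vector_mult_scaleR expand
      by (simp add: algebra_simps)
    ultimately show ?thesis by simp
  qed
  have "b \<bullet> b = 0"
  proof (rule ccontr)
    assume "b \<bullet> b \<noteq> 0"
    then have pos: "0 < b \<bullet> b" by (metis inner_ge_zero order_le_less)
    \<comment> \<open>Along \<open>v + t b\<close> the form is \<open>2 t \<bar>b\<bar>\<^sup>2 + t\<^sup>2 q b\<close>, which is negative for small negative \<open>t\<close>; the
      \<open>+ 1\<close> only keeps the denominator positive.\<close>
    define t where "t = - (b \<bullet> b) / (q b + 1)"
    have "0 \<le> 2 * t * (b \<bullet> b) + t\<^sup>2 * q b" using q[of "v + t *\<^sub>R b"] qb by simp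
    moreover have "t * (q b + 1) = - (b \<bullet> b)" using q[of b] by (simp add: t_def)
    then have "t * (t * (q b + 1)) = t * (- (b \<bullet> b))" by simp
    then have "t\<^sup>2 * q b = - (t * (b \<bullet> b)) - t\<^sup>2"
      by (simp add: power2_eq_square algebra_simps)
    moreover have "t < 0" using pos q[of b] by (simp add: t_def divide_neg_pos add_nonneg_pos)
    then have "t * (b \<bullet> b) < 0" using pos by (rule mult_neg_pos)
    ultimately show False using zero_le_power2[of t] by linarith
  qed
  then have SS: "S *v (S *v v) = k\<^sup>2 *\<^sub>R v" by (simp add: b_def)
  have k0: "0 \<le> k" by (simp add: k_def)
  define w where "w = S *v v + k *\<^sub>R v"
  show thesis
  proof (cases "w = 0")
    case True
    have "v \<noteq> 0" using v by auto
    moreover have "S *v v = (- k) *\<^sub>R v" using True by (simp add: w_def add_eq_0_iff2)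
    ultimately have "- k \<in> eigenvalues S" unfolding eigenvalues_def by blast
    then show thesis using k k0 that by simp
  next
    case False
    have "S *v w = k *\<^sub>R w"
      by (simp add: w_def matrix_vector_right_distrib matrix_vector_mult_scaleR SS power2_eq_square algebra_simps)
    then have "k \<in> eigenvalues S" using False unfolding eigenvalues_def by blast
    then show thesis using k k0 that by simp
  qed
qed

text \<open>
  Eigenvectors for different eigenvalues are orthogonal, hence linearly independent. Finiteness
  makes \<open>Max\<close> in \<open>max_abs_eigenvalue\<close> a true upper bound.
\<close>

lemma finite_eigenvalues_symmetric:
  fixes S :: "real^'n^'n"
  assumes sym: "transpose S = S"
  shows "finite (eigenvalues S)"
proof -
  define e where "e = (\<lambda>m. SOME v. v \<noteq> 0 \<and> S *v v = m *\<^sub>R v)"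
  have e: "e m \<noteq> 0 \<and> S *v e m = m *\<^sub>R e m" if "m \<in> eigenvalues S" for m
    unfolding e_def by (rule someI_ex) (use that in \<open>simp add: eigenvalues_def\<close>)
  have orth: "e m \<bullet> e n = 0" if "m \<in> eigenvalues S" "n \<in> eigenvalues S" "m \<noteq> n" for m n
    using symmetric_matrix_inner[OF sym, of "e m" "e n"] e[OF that(1)] e[OF that(2)] that(3) by simp
  then have inj: "inj_on e (eigenvalues S)"
    using e by (metis inj_onI inner_eq_zero_iff)
  have "pairwise orthogonal (e ` eigenvalues S)"
    using orth by (auto simp: pairwise_def orthogonal_def)
  then have "finite (e ` eigenvalues S)"
    using e by (intro independent_imp_finite pairwise_orthogonal_independent) auto
  then show ?thesis using finite_imageD inj by blast
qed

lemma norm_symmetric_mult_le: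
  fixes S :: "real^'n^'n"
  assumes sym: "transpose S = S"
  shows "norm (S *v x) \<le> max_abs_eigenvalue S * norm x"
proof -
  obtain m where m: "m \<in> eigenvalues S" "\<And>x. norm (S *v x) \<le> \<bar>m\<bar> * norm x"
    using symmetric_eigenvalue_max[OF sym] by metis
  have "\<bar>m\<bar> \<le> max_abs_eigenvalue S"
    unfolding max_abs_eigenvalue_def using m(1) finite_eigenvalues_symmetric[OF sym] by auto
  then show ?thesis
    using m(2) mult_right_mono norm_ge_zero order_trans by blast
qed


section \<open>Concavity of the reciprocal\<close>

text \<open>
  \<open>W\<close> is the vorticity carried by a particle and \<open>V\<close> its derivative. If \<open>N = \<bar>W\<bar>\<^sup>2\<close> had a positive
  derivative at \<open>t0\<close>, then \<open>N\<close>, being convex, would stay positive, and \<open>1/N\<close> would be a concave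
  function with negative slope at \<open>t0\<close>, so it would reach 0 in finite time.
\<close>

lemma concave_reciprocal_no_growth:
  fixes W V :: "real \<Rightarrow> 'a::real_inner"
  assumes W: "\<And>t. t0 \<le> t \<Longrightarrow> (W has_vector_derivative V t) (at t)"
    and V: "\<And>t. t0 \<le> t \<Longrightarrow> (V has_vector_derivative l t *\<^sub>R W t) (at t)"
    and Vle: "\<And>t. t0 \<le> t \<Longrightarrow> norm (V t) \<le> m t * norm (W t)"
    and l: "\<And>t. t0 \<le> t \<Longrightarrow> 3 * (m t)\<^sup>2 \<le> l t"
  shows "W t0 \<bullet> V t0 \<le> 0"
proof (rule ccontr)
  assume "\<not> ?thesis"
  then have pos0: "0 < W t0 \<bullet> V t0" by simp
  have dN: "((\<lambda>t. W t \<bullet> W t) has_real_derivative 2 * (W t \<bullet> V t)) (at t)" if "t0 \<le> t" for t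
    using W[OF that] unfolding has_vector_derivative_def has_field_derivative_def
    by (auto intro!: derivative_eq_intros simp: inner_commute algebra_simps fun_eq_iff)
  have dM: "((\<lambda>t. W t \<bullet> V t) has_real_derivative V t \<bullet> V t + l t * (W t \<bullet> W t)) (at t)" if "t0 \<le> t" for t
    using W[OF that] V[OF that] unfolding has_vector_derivative_def has_field_derivative_def
    by (auto intro!: derivative_eq_intros simp: inner_commute algebra_simps fun_eq_iff)
  have l0: "0 \<le> l t" if "t0 \<le> t" for t
    using l[OF that] by (meson mult_nonneg_nonneg order_trans zero_le_numeral zero_le_power2)
  have grow: "W t0 \<bullet> V t0 \<le> W t \<bullet> V t" if "t0 \<le> t" for t
  proof (rule DERIV_nonneg_imp_nondecreasing[OF that])
    fix s assume "t0 \<le> s" "s \<le> t"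
    then show "\<exists>y. ((\<lambda>t. W t \<bullet> V t) has_real_derivative y) (at s) \<and> 0 \<le> y"
      using dM[of s] l0[of s] by (intro exI[of _ "V s \<bullet> V s + l s * (W s \<bullet> W s)"]) auto
  qed
  have pos: "0 < W t \<bullet> W t" if "t0 \<le> t" for t
    using grow[OF that] pos0 by (metis inner_eq_zero_iff inner_ge_zero inner_zero_left not_le order_le_less)
  define g where "g = (\<lambda>t. 1 / (W t \<bullet> W t))"
  define g' where "g' = (\<lambda>t. - 2 * (W t \<bullet> V t) / (W t \<bullet> W t)\<^sup>2)"
  have dg: "(g has_real_derivative g' t) (at t)" if "t0 \<le> t" for t
    unfolding g_def g'_def using pos[OF that]
    by (auto intro!: derivative_eq_intros dN[OF that] simp: power2_eq_square)
  have g'_decreasing: "g' t \<le> g' t0" if "t0 \<le> t" for t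
  proof (rule DERIV_nonpos_imp_nonincreasing[OF that])
    fix s assume s: "t0 \<le> s" "s \<le> t"
    let ?N = "W s \<bullet> W s" and ?M = "W s \<bullet> V s" and ?P = "V s \<bullet> V s"
    have N: "0 < ?N" using pos s by simp
    have "(g' has_real_derivative (- 2 * (?P + l s * ?N) * ?N\<^sup>2 + 2 * ?M * (2 * ?N * (2 * ?M))) / (?N\<^sup>2)\<^sup>2) (at s)"
      unfolding g'_def using N s
      by (auto intro!: derivative_eq_intros dN[OF s(1)] dM[OF s(1)] simp: power2_eq_square algebra_simps diff_divide_distrib add_divide_distrib)
    moreover have "- 2 * (?P + l s * ?N) * ?N\<^sup>2 + 2 * ?M * (2 * ?N * (2 * ?M)) \<le> 0"
    proof -
      have cs: "?M\<^sup>2 \<le> ?N * ?P" by (rule Cauchy_Schwarz_ineq)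
      have "?P \<le> (m s)\<^sup>2 * ?N"
        using power_mono[OF Vle[OF s(1)], of 2] by (simp add: power_mult_distrib power2_norm_eq_inner)
      also have "3 * \<dots> \<le> l s * ?N"
        using mult_right_mono[OF l[OF s(1)], of ?N] N by simp
      finally have "3 * ?P \<le> l s * ?N" by simp
      then have "?N\<^sup>2 * (3 * ?P) \<le> ?N\<^sup>2 * (l s * ?N)" by (rule mult_left_mono) simp
      moreover have "?N * ?M\<^sup>2 \<le> ?N * (?N * ?P)" using cs N by (intro mult_left_mono) auto
      ultimately show ?thesis by (simp add: power2_eq_square algebra_simps)
    qed
    ultimately show "\<exists>y. (g' has_real_derivative y) (at s) \<and> y \<le> 0"
      using divide_nonpos_nonneg zero_le_power2 by blast
  qed
  have neg: "g' t0 < 0" using pos0 pos[of t0] by (simp add: g'_def)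
  \<comment> \<open>The zero of the tangent to \<open>1/N\<close> at \<open>t0\<close>.\<close>
  define T where "T = t0 - g t0 / g' t0"
  have "0 < g t0" using pos[of t0] by (simp add: g_def)
  then have T: "t0 < T" using neg by (simp add: T_def divide_pos_neg)
  then obtain s where s: "t0 < s" "s < T" "g T - g t0 = (T - t0) * g' s"
    using MVT2[of t0 T g g'] dg by auto
  then have "g T - g t0 \<le> (T - t0) * g' t0"
    using g'_decreasing[of s] T by (simp add: mult_left_mono)
  also have "\<dots> = - g t0" using neg by (simp add: T_def)
  finally have "g T \<le> 0" by simp
  moreover have "0 < g T" using pos[of T] T by (simp add: g_def)
  ultimately show False by simp
qed

section \<open>Evolution of the enstrophy\<close>

lemma norm_curl_square:
  "(norm (curl u x t))\<^sup>2 =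
    (velocity_gradient u x t $ 3 $ 2 - velocity_gradient u x t $ 2 $ 3)\<^sup>2 +
    (velocity_gradient u x t $ 1 $ 3 - velocity_gradient u x t $ 3 $ 1)\<^sup>2 +
    (velocity_gradient u x t $ 2 $ 1 - velocity_gradient u x t $ 1 $ 2)\<^sup>2"
  unfolding power2_norm_eq_inner inner_vec_def sum_3 curl_velocity_gradient Let_def
  by (simp add: power2_eq_square)

lemma norm_curl_square_le: "(norm (curl u x t))\<^sup>2 \<le> 12 * (norm (velocity_gradient u x t))\<^sup>2"
proof -
  let ?J = "velocity_gradient u x t"
  have entry: "\<bar>?J $ i $ j\<bar> \<le> norm ?J" for i j
    using order_trans[OF component_le_norm_cart Finite_Cartesian_Product.norm_nth_le] .
  have "(?J $ i $ j - ?J $ j $ i)\<^sup>2 \<le> (2 * norm ?J)\<^sup>2" for i j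
    using entry[of i j] entry[of j i] by (intro power2_le_iff_abs_le[THEN iffD2]) auto
  from add_mono[OF add_mono[OF this[of 3 2] this[of 1 3]] this[of 2 1]]
  show ?thesis by (simp add: norm_curl_square power_mult_distrib)
qed

lemma enstrophy_eq_integral: "enstrophy u \<Omega> t = (LINT x:\<Omega> t|lebesgue. (norm (curl u x t))\<^sup>2)"
proof -
  have "0 \<le> (LINT x:\<Omega> t|lebesgue. (norm (curl u x t))\<^sup>2)"
    unfolding set_lebesgue_integral_def by (intro Bochner_Integration.integral_nonneg) auto
  then show ?thesis by (simp add: enstrophy_def L2_norm_def)
qed

text \<open>
  Half the derivative of \<open>\<bar>\<omega>\<bar>\<^sup>2\<close> along a trajectory, at time \<open>t0\<close>.
\<close>

lemma enstrophy_density_nonincreasing: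
  assumes u: "smooth_field u" and p: "smooth_field p" and euler: "euler_solution u p" and t0: "0 < t0"
    and X: "\<And>t. t0 \<le> t \<Longrightarrow> (X has_vector_derivative u (X t) t) (at t)"
    and P: "\<And>t. t0 \<le> t \<Longrightarrow> pressure_hessian p (X t) t *v curl u (X t) t = - lam t *\<^sub>R curl u (X t) t"
    and lam: "\<And>t. t0 \<le> t \<Longrightarrow> 3 * (max_abs_eigenvalue (strain u (X t) t))\<^sup>2 \<le> lam t"
  shows "curl u (X t0) t0 \<bullet> (strain u (X t0) t0 *v curl u (X t0) t0) \<le> 0"
proof (rule concave_reciprocal_no_growth[where l = lam and m = "\<lambda>t. max_abs_eigenvalue (strain u (X t) t)"
      and W = "\<lambda>t. curl u (X t) t" and V = "\<lambda>t. strain u (X t) t *v curl u (X t) t"])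
  fix t assume t: "t0 \<le> t"
  then have "0 < t" using t0 by simp
  note along = vorticity_along_trajectory[OF u p euler this X[OF t]]
  show "((\<lambda>t. curl u (X t) t) has_vector_derivative strain u (X t) t *v curl u (X t) t) (at t)"
    by (rule along(1))
  show "((\<lambda>t. strain u (X t) t *v curl u (X t) t) has_vector_derivative lam t *\<^sub>R curl u (X t) t) (at t)"
    using along(2) by (simp add: P[OF t])
  show "norm (strain u (X t) t *v curl u (X t) t) \<le> max_abs_eigenvalue (strain u (X t) t) * norm (curl u (X t) t)"
    by (rule norm_symmetric_mult_le[OF transpose_strain])
qed (rule lam)

text \<open>
  Volume preservation moves the integral to the fixed domain \<open>\<Omega> 0\<close>, where the derivative can be
  taken under the integral. The trajectories from the compact set \<open>closure (\<Omega> 0)\<close> stay bounded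
  on a bounded time interval, so the velocity gradient, and with it the integrand and its time
  derivative, is bounded along them.
\<close>

lemma enstrophy_material_derivative:
  assumes u: "smooth_field u" and p: "smooth_field p" and euler: "euler_solution u p"
    and open0: "open (\<Omega> 0)" and bounded0: "bounded (\<Omega> 0)"
    and start: "\<And>a. a \<in> closure (\<Omega> 0) \<Longrightarrow> X a 0 = a"
    and trajectory: "\<And>a t. a \<in> closure (\<Omega> 0) \<Longrightarrow> 0 \<le> t \<Longrightarrow>
      (X a has_vector_derivative u (X a t) t) (at t within {0..})"
    and carried: "\<And>t. 0 \<le> t \<Longrightarrow> \<Omega> t = (\<lambda>a. X a t) ` \<Omega> 0"
    and t: "0 < t"
  shows "(enstrophy u \<Omega> has_real_derivative
    (LINT a:\<Omega> 0|lebesgue. 2 * (curl u (X a t) t \<bullet> (strain u (X a t) t *v curl u (X a t) t)))) (at t)"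
proof -
  let ?D = "closure (\<Omega> 0)" and ?J = "velocity_gradient u"
  interpret flow u ?J ?D X
    by unfold_locales (rule smooth_velocity_jacobian[OF u] start trajectory | assumption)+
  let ?f = "\<lambda>a s. (norm (curl u (X a s) s))\<^sup>2"
  let ?f' = "\<lambda>a s. 2 * (curl u (X a s) s \<bullet> (strain u (X a s) s *v curl u (X a s) s))"
  \<comment> \<open>The derivative at \<open>t\<close> is two-sided, so the bounds have to hold slightly beyond \<open>t\<close>.\<close>
  define T where "T = t + 1"
  have T: "0 \<le> T" "0 < T" using t by (auto simp: T_def)
  have sub: "a \<in> ?D" "a \<in> interior ?D" if "a \<in> \<Omega> 0" for a
    using that closure_subset interior_maximal[OF closure_subset open0] by blast+
  obtain R where R: "\<And>a s. a \<in> ?D \<Longrightarrow> s \<in> {0..T} \<Longrightarrow> norm (X a s) \<le> R"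
    using trajectories_uniformly_bounded[OF _ T(1)] bounded0 compact_closure by metis
  obtain L where L: "0 \<le> L" and JL: "\<And>x s. s \<in> {0..T} \<Longrightarrow> norm x \<le> R \<Longrightarrow> norm (?J x s) \<le> L"
    using locally_lipschitz[of T R] by metis
  have fL: "?f a s \<le> 12 * L\<^sup>2" if "a \<in> \<Omega> 0" "s \<in> {0..T}" for a s
  proof -
    have "?f a s \<le> 12 * (norm (?J (X a s) s))\<^sup>2" by (rule norm_curl_square_le)
    also have "\<dots> \<le> 12 * L\<^sup>2"
      using JL[OF that(2) R[OF sub(1)[OF that(1)] that(2)]] by (simp add: power_mono)
    finally show ?thesis .
  qed
  have preserving: "\<exists>g'. ((\<lambda>b. X b s) has_derivative g') (at a) \<and> \<bar>det (matrix g')\<bar> = 1"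
    if a: "a \<in> \<Omega> 0" and s: "s \<in> {0..T}" for a s
  proof -
    obtain Y where Y0: "\<And>j. Y j 0 = axis j 1"
      and Y: "\<And>j r. r \<in> {0..T} \<Longrightarrow> (Y j has_vector_derivative ?J (X a r) r *v Y j r) (at r within {0..T})"
      and dX: "\<And>r. r \<in> {0..T} \<Longrightarrow> ((\<lambda>b. X b r) has_derivative (\<lambda>w. \<Sum>j\<in>UNIV. w $ j *\<^sub>R Y j r)) (at a)"
      by (rule flow_derivative[OF sub(2)[OF a] T(1)]) blast
    have "det (\<chi> i j. Y j s $ i) = det (\<chi> i j. Y j 0 $ i)"
      using euler by (intro liouville_3[OF Y _ s]) (auto simp: trace_velocity_gradient euler_solution_def)
    also have "(\<chi> i j. Y j 0 $ i) = (mat 1 :: real^3^3)"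
      by (simp add: Y0 vec_eq_iff mat_def axis_def)
    finally have "det (\<chi> i j. Y j s $ i) = 1" by simp
    moreover have "matrix (\<lambda>w. \<Sum>j\<in>UNIV. w $ j *\<^sub>R Y j s) = (\<chi> i j. Y j s $ i)"
      by (simp add: matrix_def vec_eq_iff axis_def if_distrib[of "\<lambda>c. c * _"] cong: if_cong)
    ultimately show ?thesis using dX[OF s] by force
  qed
  have int: "set_integrable lebesgue (\<Omega> 0) (\<lambda>a. ?f a s)" if s: "s \<in> {0..T}" for s
  proof (rule set_integrable_bounded_continuous[OF open0 bounded0])
    have "continuous_on (\<Omega> 0) (\<lambda>a. X a s)"
    proof (rule continuous_at_imp_continuous_on, rule ballI)
      fix a assume "a \<in> \<Omega> 0"
      then show "isCont (\<lambda>a. X a s) a"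
        using preserving s has_derivative_continuous by blast
    qed
    then have "continuous_on (\<Omega> 0) (\<lambda>a. (X a s, s))" by (intro continuous_intros)
    then have "continuous_on (\<Omega> 0) (\<lambda>a. ?J (X a s) s)"
      using continuous_on_compose2[OF continuous_jacobian, of "\<Omega> 0" "\<lambda>a. (X a s, s)"] s by auto
    then show "continuous_on (\<Omega> 0) (\<lambda>a. ?f a s)"
      unfolding norm_curl_square by (intro continuous_intros)
  qed (use fL[OF _ s] in auto)
  have volume: "enstrophy u \<Omega> s = (LINT a:\<Omega> 0|lebesgue. ?f a s)" if s: "s \<in> {0..T}" for s
  proof -
    have "\<forall>a\<in>\<Omega> 0. \<exists>g'. ((\<lambda>b. X b s) has_derivative g') (at a) \<and> \<bar>det (matrix g')\<bar> = 1"
      using preserving s by blast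
    from bchoice[OF this] obtain g' where g': "\<And>a. a \<in> \<Omega> 0 \<Longrightarrow> ((\<lambda>b. X b s) has_derivative g' a) (at a)"
      "\<And>a. a \<in> \<Omega> 0 \<Longrightarrow> \<bar>det (matrix (g' a))\<bar> = 1" by blast
    have "(LINT x:(\<lambda>a. X a s) ` \<Omega> 0|lebesgue. (norm (curl u x s))\<^sup>2) = (LINT a:\<Omega> 0|lebesgue. ?f a s)"
    proof (rule integral_volume_preserving)
      show "inj_on (\<lambda>a. X a s) (\<Omega> 0)"
        using trajectories_inj sub(1) s by (intro inj_onI) auto
    qed (use open0 g' int[OF s] in \<open>auto intro: has_derivative_at_withinI lebesgue_openin\<close>)
    then show ?thesis
      using carried[of s] s by (simp add: enstrophy_eq_integral)
  qed
  have "((\<lambda>s. LINT a:\<Omega> 0|lebesgue. ?f a s) has_real_derivative (LINT a:\<Omega> 0|lebesgue. ?f' a t)) (at t)"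
  proof (rule has_real_derivative_set_integral[where I = "{0<..<T}" and B = "24 * L\<^sup>2 * L"])
    fix a s assume a: "a \<in> \<Omega> 0" and s: "s \<in> {0<..<T}"
    let ?\<omega> = "curl u (X a s) s"
    have "at s within {0..} = at s"
      using s by (intro at_within_interior) (simp add: interior_real_atLeast)
    then have "(X a has_vector_derivative u (X a s) s) (at s)"
      using trajectory[OF sub(1)[OF a], of s] s by simp
    then have "((\<lambda>s. curl u (X a s) s) has_vector_derivative strain u (X a s) s *v ?\<omega>) (at s)"
      using s by (intro vorticity_along_trajectory[OF u p euler]) auto
    then show "(?f a has_real_derivative ?f' a s) (at s)"
      unfolding power2_norm_eq_inner has_vector_derivative_def has_field_derivative_def
      by (auto intro!: derivative_eq_intros simp: inner_commute algebra_simps fun_eq_iff)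
    have sT: "s \<in> {0..T}" using s by auto
    have "\<bar>?\<omega> \<bullet> (?J (X a s) s *v ?\<omega>)\<bar> \<le> norm ?\<omega> * (norm (?J (X a s) s) * norm ?\<omega>)"
      by (rule order_trans[OF Cauchy_Schwarz_ineq2]) (intro mult_left_mono norm_matrix_vector_mult_le norm_ge_zero)
    also have "\<dots> = ?f a s * norm (?J (X a s) s)" by (simp add: power2_eq_square)
    also have "\<dots> \<le> (12 * L\<^sup>2) * L"
      using fL[OF a sT] JL[OF sT R[OF sub(1)[OF a] sT]] by (intro mult_mono) auto
    finally show "\<bar>?f' a s\<bar> \<le> 24 * L\<^sup>2 * L"
      unfolding strain_mult_curl by (simp add: abs_mult mult_ac)
  qed (use open0 bounded0 t int in \<open>auto simp: T_def lmeasurable_open\<close>)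
  then show ?thesis
    by (rule has_field_derivative_transform_within_open[where S = "{0<..<T}"])
      (use t volume in \<open>auto simp: T_def\<close>)
qed

text \<open>
  The rate is half the derivative of the enstrophy, divided by its square; that derivative is an
  integral of nonpositive quantities.
\<close>

lemma enstrophy_rate_nonpos:
  assumes u: "smooth_field u" and p: "smooth_field p" and euler: "euler_solution u p"
    and mv: "material_volume u \<Omega>" and nz: "enstrophy u \<Omega> t0 \<noteq> 0" and t0: "0 < t0"
    and P: "\<And>t x. t0 \<le> t \<Longrightarrow> x \<in> \<Omega> t \<Longrightarrow>
      pressure_hessian p x t *v curl u x t = - lam x t *\<^sub>R curl u x t"
    and lam: "\<And>t x. t0 \<le> t \<Longrightarrow> x \<in> \<Omega> t \<Longrightarrow> 3 * (max_abs_eigenvalue (strain u x t))\<^sup>2 \<le> lam x t"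
  shows "enstrophy_rate u \<Omega> t0 \<le> 0"
proof -
  have open0: "open (\<Omega> 0)" and bounded0: "bounded (\<Omega> 0)"
    using mv by (auto simp: material_volume_def smooth_bounded_domain_def)
  obtain X where X: "\<forall>a\<in>closure (\<Omega> 0). X a 0 = a \<and>
      (\<forall>t\<ge>0. (X a has_vector_derivative u (X a t) t) (at t within {0..}))"
    and image: "\<forall>t\<ge>0. \<Omega> t = (\<lambda>a. X a t) ` \<Omega> 0"
    using mv unfolding material_volume_def by blast
  have start: "\<And>a. a \<in> closure (\<Omega> 0) \<Longrightarrow> X a 0 = a"
    and trajectory: "\<And>a t. a \<in> closure (\<Omega> 0) \<Longrightarrow> 0 \<le> t \<Longrightarrow>
      (X a has_vector_derivative u (X a t) t) (at t within {0..})"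
    using X by blast+
  have carried: "\<Omega> t = (\<lambda>a. X a t) ` \<Omega> 0" if "0 \<le> t" for t
    using image that by blast
  let ?g = "\<lambda>a. 2 * (curl u (X a t0) t0 \<bullet> (strain u (X a t0) t0 *v curl u (X a t0) t0))"
  let ?D = "LINT a:\<Omega> 0|lebesgue. ?g a"
  have "?g a \<le> 0" if a: "a \<in> \<Omega> 0" for a
  proof -
    have "curl u (X a t0) t0 \<bullet> (strain u (X a t0) t0 *v curl u (X a t0) t0) \<le> 0"
    proof (rule enstrophy_density_nonincreasing[OF u p euler t0, where lam = "\<lambda>t. lam (X a t) t"])
      fix t assume t: "t0 \<le> t"
      have "at t within {0..} = at t"
        using t t0 by (intro at_within_interior) (simp add: interior_real_atLeast)
      then show "(X a has_vector_derivative u (X a t) t) (at t)"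
        using trajectory[of a t] a closure_subset t t0 by fastforce
      have x: "X a t \<in> \<Omega> t" using carried[of t] a t t0 by auto
      show "pressure_hessian p (X a t) t *v curl u (X a t) t = - lam (X a t) t *\<^sub>R curl u (X a t) t"
        by (rule P[OF t x])
      show "3 * (max_abs_eigenvalue (strain u (X a t) t))\<^sup>2 \<le> lam (X a t) t"
        by (rule lam[OF t x])
    qed
    then show ?thesis by simp
  qed
  then have "0 \<le> (LINT a|lebesgue. - (indicat_real (\<Omega> 0) a *\<^sub>R ?g a))"
    by (intro Bochner_Integration.integral_nonneg) (auto simp: indicator_def)
  then have D: "?D \<le> 0"
    by (simp only: set_lebesgue_integral_def Bochner_Integration.integral_minus neg_0_le_iff_le)
  have "(enstrophy u \<Omega> has_real_derivative ?D) (at t0)"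
    by (rule enstrophy_material_derivative[OF u p euler open0 bounded0 start trajectory carried t0])
  then have "((\<lambda>s. 1 / (2 * enstrophy u \<Omega> s)) has_real_derivative - ?D / (2 * (enstrophy u \<Omega> t0)\<^sup>2)) (at t0)"
    using nz by (auto intro!: derivative_eq_intros simp: power2_eq_square field_simps)
  then have "enstrophy_rate u \<Omega> t0 = ?D / (2 * (enstrophy u \<Omega> t0)\<^sup>2)"
    unfolding enstrophy_rate_def by (simp add: DERIV_imp_deriv)
  then show ?thesis using D by (simp add: divide_nonpos_nonneg)
qed

theorem theorem2p1:
  shows "\<exists>\<tau> :: real \<Rightarrow> real \<Rightarrow> real.
    \<forall>(u :: vector_field) (p :: scalar_field) (\<Omega> :: real \<Rightarrow> (real^3) set)
      (lam :: scalar_field) (t0 :: real).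
      smooth_field u \<and> smooth_field p \<and> euler_solution u p \<and>
      material_volume u \<Omega> \<and>
      (\<forall>t\<ge>0. enstrophy u \<Omega> t \<noteq> 0) \<and>
      (\<forall>t\<ge>0. \<forall>x\<in>\<Omega> t. lam x t > 0 \<and>
         pressure_hessian p x t *v curl u x t = - lam x t *\<^sub>R curl u x t) \<and>
      t0 > 0 \<and>
      (\<forall>t\<ge>t0. \<forall>x\<in>\<Omega> t. lam x t > 3 * (max_abs_eigenvalue (strain u x t))\<^sup>2) \<and>
      enstrophy_rate u \<Omega> t0 > 0
      \<longrightarrow> (let T0 = t0 + \<tau> (enstrophy u \<Omega> t0) (enstrophy_rate u \<Omega> t0) in
            t0 < T0 \<and>
            (\<exists>Ts. t0 < Ts \<and> Ts < T0 \<and>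
               Limsup (at_left Ts)
                 (\<lambda>t. ereal (L2_norm (\<Omega> t) (\<lambda>x. material_deriv u (curl u) x t))) = \<infinity>))"
  \<comment> \<open>For the witness, \<open>1 / (2 w v)\<close> is the time that the tangent to \<open>1 / (2 \<open>enstrophy\<close>)\<close> at \<open>t0\<close>, which has slope
    \<open>- v\<close>, takes to fall from \<open>1 / (2 w)\<close> to 0: the classical bound on the life span.\<close>
proof (intro exI[of _ "\<lambda>w v. 1 / (2 * w * v)"] allI impI, elim conjE)
  fix u p \<Omega> lam and t0 :: real
  assume u: "smooth_field u" and p: "smooth_field p" and euler: "euler_solution u p"
    and mv: "material_volume u \<Omega>" and nz: "\<forall>t\<ge>0. enstrophy u \<Omega> t \<noteq> 0"
    and P: "\<forall>t\<ge>0. \<forall>x\<in>\<Omega> t. lam x t > 0 \<and>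
      pressure_hessian p x t *v curl u x t = - lam x t *\<^sub>R curl u x t"
    and t0: "t0 > 0"
    and lam: "\<forall>t\<ge>t0. \<forall>x\<in>\<Omega> t. lam x t > 3 * (max_abs_eigenvalue (strain u x t))\<^sup>2"
    and rate: "enstrophy_rate u \<Omega> t0 > 0"
  have "enstrophy_rate u \<Omega> t0 \<le> 0"
  proof (rule enstrophy_rate_nonpos[OF u p euler mv _ t0])
    show "enstrophy u \<Omega> t0 \<noteq> 0" using nz t0 by simp
    show "pressure_hessian p x t *v curl u x t = - lam x t *\<^sub>R curl u x t"
      if "t0 \<le> t" "x \<in> \<Omega> t" for t x using P that t0 by simp
    show "3 * (max_abs_eigenvalue (strain u x t))\<^sup>2 \<le> lam x t"
      if "t0 \<le> t" "x \<in> \<Omega> t" for t x using lam that by (simp add: less_imp_le)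
  qed
  with rate show "let T0 = t0 + 1 / (2 * enstrophy u \<Omega> t0 * enstrophy_rate u \<Omega> t0) in
      t0 < T0 \<and> (\<exists>Ts. t0 < Ts \<and> Ts < T0 \<and> Limsup (at_left Ts)
        (\<lambda>t. ereal (L2_norm (\<Omega> t) (\<lambda>x. material_deriv u (curl u) x t))) = \<infinity>)"
    by simp
qed

end
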